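(* Let $k\geq 3$ be an integer and let $G$ be a graph. Then there is some $C\in\mathbb{N}$ such that for all $n\in\mathbb{N}$ we have $M_{F^{(k)}(G)}(n)\leq C$.
   Context: A $k$-uniform hypergraph ($k$-graph) $H$ consists of a vertex set $V(H)$ and an edge set $E(H)\subseteq V(H)^{(k)}=\{S\subseteq V(H): |S|=k\}$. For $k$-graphs $F$ and $H$, a copy of $F$ in $H$ is a subhypergraph of $H$ isomorphic to $F$, and $c(F,H)$ denotes the number of copies of $F$ in $H$. For a $k$-graph $F$ and a $k$-graph $H$, the $F$-bootstrap percolation process ($F$-process) starting with $H$ is the sequence $(H_i)_{i\geq 0}$ of $k$-graphs on vertex set $V(H)$ defined by $H_0=H$ and $E(H_{i+1})=E(H_i)\cup\{e\in V(H)^{(k)}: c(F,H_i\cup e)>c(F,H_i)\}$, where $H_i\cup e$ is the $k$-graph $(V(H),E(H_i)\cup\{e\})$. The running time is $\tau_F(H)=\min\{t\in\mathbb{N}_{\geq 0}: H_t=H_{t+1}\}$, and $M_F(n)=\max\{\tau_F(H): H \text{ is a } k\text{-graph with } n \text{ vertices}\}$. For a graph $G=(V,E)$ and an integer $k\ge 3$, the $k$-extension $F^{(k)}(G)$ is the $k$-graph with vertex set $V\,\dot\cup\,\{v_e^i: i\in[k-2], e\in E\}$ (all $v_e^i$ distinct new vertices) and edge set $\{e\cup\{v_e^1,\dots,v_e^{k-2}\}: e\in E\}$; i.e., each edge of $G$ is enlarged by its own $(k-2)$-set of new vertices. *)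

theory Defs
  imports Complex_Main "HOL-Library.Ramsey"
begin

datatype 'a hypergraph = Hypergraph (verts: "'a set") (edges: "'a set set")

text \<open>Hypergraphs are finite throughout; \<^term>\<open>nsets V k\<close> is the set of \<open>k\<close>-element subsets of \<open>V\<close>.
  Finite simple graphs are the 2-graphs.\<close>

definition k_graph :: "nat \<Rightarrow> 'a hypergraph \<Rightarrow> bool" where
  "k_graph k H \<longleftrightarrow> finite (verts H) \<and> edges H \<subseteq> nsets (verts H) k"

definition subhypergraph :: "'a hypergraph \<Rightarrow> 'a hypergraph \<Rightarrow> bool" where
  "subhypergraph S H \<longleftrightarrow>
     verts S \<subseteq> verts H \<and> edges S \<subseteq> edges H \<and> edges S \<subseteq> Pow (verts S)"

definition isomorphic :: "'a hypergraph \<Rightarrow> 'b hypergraph \<Rightarrow> bool" where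
  "isomorphic F H \<longleftrightarrow>
     (\<exists>f. bij_betw f (verts F) (verts H) \<and> edges H = (\<lambda>e. f ` e) ` edges F)"

definition copies :: "'a hypergraph \<Rightarrow> 'b hypergraph \<Rightarrow> 'b hypergraph set" where
  "copies F H = {S. subhypergraph S H \<and> isomorphic F S}"

definition num_copies :: "'a hypergraph \<Rightarrow> 'b hypergraph \<Rightarrow> nat" where
  "num_copies F H = card (copies F H)"

definition add_edge :: "'a hypergraph \<Rightarrow> 'a set \<Rightarrow> 'a hypergraph" where
  "add_edge H e = Hypergraph (verts H) (insert e (edges H))"

definition bootstrap_step :: "nat \<Rightarrow> 'a hypergraph \<Rightarrow> 'b hypergraph \<Rightarrow> 'b hypergraph" where
  "bootstrap_step k F H = Hypergraph (verts H)
     (edges H \<union> {e \<in> nsets (verts H) k. num_copies F (add_edge H e) > num_copies F H})"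

primrec bootstrap_process :: "nat \<Rightarrow> 'a hypergraph \<Rightarrow> 'b hypergraph \<Rightarrow> nat \<Rightarrow> 'b hypergraph" where
  "bootstrap_process k F H 0 = H"
| "bootstrap_process k F H (Suc i) = bootstrap_step k F (bootstrap_process k F H i)"

definition running_time :: "nat \<Rightarrow> 'a hypergraph \<Rightarrow> 'b hypergraph \<Rightarrow> nat" where
  "running_time k F H =
     (LEAST t. bootstrap_process k F H t = bootstrap_process k F H (Suc t))"

text \<open>Up to isomorphism every starting \<open>k\<close>-graph lives on natural numbers, so the maximum is taken
  over \<open>k\<close>-graphs with \<^typ>\<open>nat\<close> vertices. That this is a maximum of a finite nonempty set is
  shown in \<open>running_times_finite_nonempty\<close> below.\<close>

definition running_times :: "nat \<Rightarrow> 'a hypergraph \<Rightarrow> nat \<Rightarrow> nat set" where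
  "running_times k F n =
     {running_time k F H | H :: nat hypergraph. k_graph k H \<and> card (verts H) = n}"

definition max_running_time :: "nat \<Rightarrow> 'a hypergraph \<Rightarrow> nat \<Rightarrow> nat" where
  "max_running_time k F n = Max (running_times k F n)"

text \<open>The new vertex \<open>v\<^sub>e\<^sup>i\<close> is \<open>Inr (e, i)\<close>.\<close>

definition extension_edge :: "nat \<Rightarrow> 'a set \<Rightarrow> ('a + 'a set \<times> nat) set" where
  "extension_edge k e = Inl ` e \<union> (\<lambda>i. Inr (e, i)) ` {1..k - 2}"

definition k_extension :: "nat \<Rightarrow> 'a hypergraph \<Rightarrow> ('a + 'a set \<times> nat) hypergraph" where
  "k_extension k G = Hypergraph
     (Inl ` verts G \<union> Inr ` (edges G \<times> {1..k - 2})) (extension_edge k ` edges G)"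

lemma verts_bootstrap_process [simp]: "verts (bootstrap_process k F H t) = verts H"
  by (induction t) (auto simp: bootstrap_step_def)

lemma k_graph_bootstrap_process:
  "k_graph k H \<Longrightarrow> k_graph k (bootstrap_process k F H t)"
  by (induction t) (auto simp: bootstrap_step_def k_graph_def)

lemma edges_bootstrap_process_Suc:
  "edges (bootstrap_process k F H t) \<subseteq> edges (bootstrap_process k F H (Suc t))"
  by (auto simp: bootstrap_step_def)

lemma bootstrap_process_stabilises:
  assumes "k_graph k H"
  shows "\<exists>t \<le> card (verts H) choose k.
           bootstrap_process k F H t = bootstrap_process k F H (Suc t)"
proof (rule ccontr)
  let ?P = "bootstrap_process k F H" and ?N = "card (verts H) choose k"
  assume neg: "\<not> ?thesis"
  have sub: "edges (?P t) \<subseteq> nsets (verts H) k" for t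
    using k_graph_bootstrap_process[OF assms, of F t] by (simp add: k_graph_def)
  have fin: "finite (nsets (verts H) k)"
    using assms by (simp add: k_graph_def finite_imp_finite_nsets)
  have "t \<le> card (edges (?P t))" if "t \<le> Suc ?N" for t
    using that
  proof (induction t)
    case (Suc t)
    have "?P t \<noteq> ?P (Suc t)"
      using neg Suc.prems by auto
    hence "edges (?P t) \<noteq> edges (?P (Suc t))"
      by (metis hypergraph.expand verts_bootstrap_process)
    hence "edges (?P t) \<subset> edges (?P (Suc t))"
      using edges_bootstrap_process_Suc[of k F H t] by blast
    hence "card (edges (?P t)) < card (edges (?P (Suc t)))"
      by (meson psubset_card_mono finite_subset sub fin)
    thus ?case using Suc by simp
  qed simp
  from this[of "Suc ?N"] have "Suc ?N \<le> card (edges (?P (Suc ?N)))" by blast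
  also have "\<dots> \<le> card (nsets (verts H) k)"
    by (rule card_mono[OF fin sub])
  finally show False by (simp add: card_nsets)
qed

lemma running_times_finite_nonempty:
  "finite (running_times k F n)" "running_times k F n \<noteq> {}"
proof -
  have "running_time k F H \<le> n choose k" if "k_graph k H" "card (verts H) = n" for H :: "nat hypergraph"
    using bootstrap_process_stabilises[OF that(1), of F] that(2)
    unfolding running_time_def by (metis (mono_tags, lifting) Least_le le_trans)
  hence "running_times k F n \<subseteq> {..n choose k}"
    by (auto simp: running_times_def)
  thus "finite (running_times k F n)"
    using finite_subset by blast
  have "k_graph k (Hypergraph {..<n} {})" "card (verts (Hypergraph {..<n} {})) = n"
    by (simp_all add: k_graph_def)
  thus "running_times k F n \<noteq> {}"
    unfolding running_times_def by blast
qed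

end

theory Submission
  imports Defs
begin

text \<open>
  A copy of the extension of \<open>G\<close> amounts to an injection of the core \<open>V(G)\<close> into the host together
  with hyperedges over the images of the edges of \<open>G\<close> that meet only in the core. One step after a
  copy appears, each of its core pairs is flexible: hyperedges through it avoid any prescribed small
  set of vertices. Hence only core pairs matter for the further evolution.

  If many copies form a sunflower through a common core vertex \<open>h\<close>, then \<open>h\<close> is a hub, flexible
  with all but boundedly many vertices, because the other ends of the edges at \<open>h\<close> can serve as
  private vertices. If the copies of a sunflower spread out both ends of an edge \<open>ab\<close> of \<open>G\<close>, then
  moving \<open>a\<close> in one copy to its position in any of the other ones makes the image of \<open>b\<close> a hub. Sufficiently
  many hubs complete the whole hypergraph in three steps. While the set of hubs does not change, core
  pairs between hubs and ordinary vertices are irrelevant, since they are flexible anyway, and a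
  large number of other core pairs would contain one of the two kinds of sunflower and create a new
  hub. So the number of other core pairs is bounded, and the process stops as soon as it does not
  grow for three steps.
\<close>

section \<open>Ramsey-type selection\<close>

text \<open>The colour of a pair is read in increasing order of its indices only, so it may record
  an asymmetric relation between the two.\<close>

definition ramsey_bound :: "'c set \<Rightarrow> nat \<Rightarrow> nat \<Rightarrow> bool" where
  "ramsey_bound C m M \<longleftrightarrow> (\<forall>col. (\<forall>i j. i < j \<and> j < M \<longrightarrow> col i j \<in> C) \<longrightarrow>
    (\<exists>J c. J \<subseteq> {..<M} \<and> card J = m \<and> (\<forall>i\<in>J. \<forall>j\<in>J. i < j \<longrightarrow> col i j = c)))"

lemma ramsey_boundE:
  assumes "ramsey_bound C m M" and "\<And>i j. i < j \<Longrightarrow> j < M \<Longrightarrow> col i j \<in> C"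
  obtains J c where "J \<subseteq> {..<M}" "card J = m" "\<And>i j. i \<in> J \<Longrightarrow> j \<in> J \<Longrightarrow> i < j \<Longrightarrow> col i j = c"
proof -
  have "\<exists>J c. J \<subseteq> {..<M} \<and> card J = m \<and> (\<forall>i\<in>J. \<forall>j\<in>J. i < j \<longrightarrow> col i j = c)"
    using assms unfolding ramsey_bound_def by simp
  thus thesis using that by metis
qed

lemma ramsey_bound_exists:
  assumes "finite C"
  shows "\<exists>M. ramsey_bound C m M"
proof -
  obtain g where g: "bij_betw g C {..<card C}"
    using assms bij_betw_iff_card[of C "{..<card C}"] by auto
  obtain M where M: "partn_lst {..<M::nat} (replicate (card C) m) 2"
    using ramsey_full by blast
  show ?thesis
    unfolding ramsey_bound_def
  proof (intro exI[of _ M] allI impI)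
    fix col assume col: "\<forall>i j. i < j \<and> j < M \<longrightarrow> col i j \<in> C"
    \<comment> \<open>\<open>ramsey_full\<close> colours unordered pairs by numbers:
      \<open>Min\<close> and \<open>Max\<close> recover the order of a pair, and \<open>g\<close>
      numbers the colours.\<close>
    define f where "f = (\<lambda>e. g (col (Min e) (Max e)))"
    have f_pair: "f {i, j} = g (col i j)" if "i < j" for i j
      using that by (simp add: f_def)
    have "f \<in> nsets {..<M} 2 \<rightarrow> {..<card C}"
    proof
      fix e assume "e \<in> nsets {..<M} 2"
      then obtain i j where "e = {i, j}" "i < j" "j < M"
        by (auto simp: ordered_nsets_2_eq)
      thus "f e \<in> {..<card C}"
        using f_pair col g by (metis bij_betw_apply)
    qed
    then obtain i J where i: "i < card C" "J \<in> nsets {..<M} m" "f ` nsets J 2 \<subseteq> {i}"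
      using partn_lstE[OF M, of f "card C"] by (metis length_replicate nth_replicate)
    have "col a b = the_inv_into C g i" if "a \<in> J" "b \<in> J" "a < b" for a b
    proof -
      have "{a, b} \<in> nsets J 2" using that by auto
      hence "f {a, b} \<in> {i}" using i(3) by blast
      hence "g (col a b) = i" using f_pair[OF that(3)] by simp
      moreover have "col a b \<in> C" using that i(2) col by (auto simp: nsets_def)
      ultimately show ?thesis
        using g by (metis bij_betw_def the_inv_into_f_f)
    qed
    moreover have "J \<subseteq> {..<M}" "card J = m" using i(2) by (auto simp: nsets_def)
    ultimately show "\<exists>J c. J \<subseteq> {..<M} \<and> card J = m \<and> (\<forall>i\<in>J. \<forall>j\<in>J. i < j \<longrightarrow> col i j = c)"
      by blast
  qed
qed

lemma enumerate_large_set: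
  assumes "M \<le> card I" and "M > 0"
  obtains h :: "nat \<Rightarrow> 'i" where "inj_on h {..<M}" "h ` {..<M} \<subseteq> I"
proof -
  obtain I' where I': "I' \<subseteq> I" "card I' = M" "finite I'"
    using assms(1) obtain_subset_with_card_n by metis
  then obtain h where "bij_betw h {..<M} I'"
    using bij_betw_iff_card[of "{..<M}" I'] by auto
  thus ?thesis using that I' by (auto simp: bij_betw_def)
qed

text \<open>Colour a pair by which of its two members lies in the forbidden set of the other. If a
  homogeneous colour contained such a membership, the forbidden set of the first or of the last
  element would contain all the others, which are more than \<open>N\<close>.\<close>

lemma ramsey_independent:
  fixes N v :: nat
  shows "\<exists>M. \<forall>(A::'x set) B. M \<le> card A \<longrightarrow> (\<forall>h\<in>A. finite (B h) \<and> card (B h) \<le> N) \<longrightarrow>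
    (\<exists>A'\<subseteq>A. card A' = v \<and> finite A' \<and> (\<forall>h\<in>A'. \<forall>h'\<in>A'. h \<noteq> h' \<longrightarrow> h \<notin> B h'))"
proof -
  obtain M where M: "ramsey_bound (UNIV::(bool \<times> bool) set) (v + N + 2) M"
    using ramsey_bound_exists[of "UNIV::(bool \<times> bool) set" "v + N + 2"] by auto
  show ?thesis
  \<comment> \<open>\<open>Suc\<close> makes the bound positive, which excludes infinite sets, whose
    \<open>card\<close> is 0.\<close>
  proof (intro exI[of _ "Suc M"] allI impI)
    fix A :: "'x set" and B :: "'x \<Rightarrow> 'x set"
    assume A: "Suc M \<le> card A" and B: "\<forall>h\<in>A. finite (B h) \<and> card (B h) \<le> N"
    obtain h :: "nat \<Rightarrow> 'x" where h: "inj_on h {..<Suc M}" "h ` {..<Suc M} \<subseteq> A"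
      using enumerate_large_set[OF A] by auto
    obtain J c where J: "J \<subseteq> {..<M}" "card J = v + N + 2"
      and c: "\<And>i j. i \<in> J \<Longrightarrow> j \<in> J \<Longrightarrow> i < j \<Longrightarrow> (h j \<in> B (h i), h i \<in> B (h j)) = c"
      by (rule ramsey_boundE[OF M, of "\<lambda>i j. (h j \<in> B (h i), h i \<in> B (h j))"]) auto
    have fJ: "finite J" "J \<noteq> {}" using J by (auto intro: finite_subset)
    have J_A: "h i \<in> A" if "i \<in> J" for i using that J(1) h(2) by force
    have inj: "inj_on h J" by (rule inj_on_subset[OF h(1)]) (use J(1) in auto)
    have absorbed: False if "i \<in> J" "h ` (J - {i}) \<subseteq> B (h i)" for i
    proof -
      have "card (J - {i}) = card (h ` (J - {i}))"
        using inj by (metis card_image inj_on_diff)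
      also have "\<dots> \<le> card (B (h i))" using that(2) B J_A[OF that(1)] card_mono by blast
      also have "\<dots> \<le> N" using B J_A[OF that(1)] by blast
      finally show False using J(2) fJ that(1) by simp
    qed
    have "\<not> fst c"
    proof
      assume *: "fst c"
      have "h ` (J - {Min J}) \<subseteq> B (h (Min J))"
      proof
        fix y assume "y \<in> h ` (J - {Min J})"
        then obtain j where j: "y = h j" "j \<in> J" "Min J < j"
          using fJ by (auto simp: order.strict_iff_order)
        have "(h j \<in> B (h (Min J)), h (Min J) \<in> B (h j)) = c"
          by (rule c) (use j(2,3) fJ Min_in in auto)
        thus "y \<in> B (h (Min J))" using * j(1) by auto
      qed
      thus False using absorbed fJ Min_in by blast
    qed
    moreover have "\<not> snd c"
    proof
      assume *: "snd c"
      have "h ` (J - {Max J}) \<subseteq> B (h (Max J))"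
      proof
        fix y assume "y \<in> h ` (J - {Max J})"
        then obtain j where j: "y = h j" "j \<in> J" "j < Max J"
          using fJ by (auto simp: order.strict_iff_order)
        have "(h (Max J) \<in> B (h j), h j \<in> B (h (Max J))) = c"
          by (rule c) (use j(2,3) fJ Max_in in auto)
        thus "y \<in> B (h (Max J))" using * j(1) by auto
      qed
      thus False using absorbed fJ Max_in by blast
    qed
    ultimately have indep: "h i \<notin> B (h j)" if "i \<in> J" "j \<in> J" "i \<noteq> j" for i j
    proof (cases "i < j")
      case True
      hence "(h j \<in> B (h i), h i \<in> B (h j)) = c" using c that by metis
      thus ?thesis using \<open>\<not> snd c\<close> by auto
    next
      case False
      hence "j < i" using that(3) by simp
      hence "(h i \<in> B (h j), h j \<in> B (h i)) = c" using c that by metis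
      thus ?thesis using \<open>\<not> fst c\<close> by auto
    qed
    obtain J' where J': "J' \<subseteq> J" "card J' = v"
      using J(2) obtain_subset_with_card_n[of v J] by auto
    have "card (h ` J') = v" using J' inj by (metis card_image inj_on_subset)
    moreover have "finite (h ` J')" using J' fJ finite_subset by blast
    ultimately show "\<exists>A'\<subseteq>A. card A' = v \<and> finite A' \<and> (\<forall>h\<in>A'. \<forall>h'\<in>A'. h \<noteq> h' \<longrightarrow> h \<notin> B h')"
      using indep J' J_A by (intro exI[of _ "h ` J'"] conjI) (blast | assumption)+
  qed
qed

section \<open>Sunflowers of injections\<close>

text \<open>A Delta-system of labelled images: the kernel \<open>K\<close> is a set of positions in
  the domain, so a common vertex is taken by the same position in every member.\<close>

definition sunflower :: "'i set \<Rightarrow> ('i \<Rightarrow> 'x \<Rightarrow> 'y) \<Rightarrow> 'x set \<Rightarrow> 'x set \<Rightarrow> bool" where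
  "sunflower J \<psi> X K \<longleftrightarrow> K \<subseteq> X \<and> (\<forall>x\<in>K. \<forall>i\<in>J. \<forall>j\<in>J. \<psi> i x = \<psi> j x) \<and>
     (\<forall>i\<in>J. \<forall>j\<in>J. i \<noteq> j \<longrightarrow> (\<forall>x\<in>X - K. \<forall>y\<in>X. \<psi> i x \<noteq> \<psi> j y))"

lemma sunflower_kernel: "sunflower J \<psi> X K \<Longrightarrow> x \<in> K \<Longrightarrow> i \<in> J \<Longrightarrow> j \<in> J \<Longrightarrow> \<psi> i x = \<psi> j x"
  unfolding sunflower_def by blast

lemma sunflower_petal:
  "sunflower J \<psi> X K \<Longrightarrow> x \<in> X \<Longrightarrow> x \<notin> K \<Longrightarrow> y \<in> X \<Longrightarrow> i \<in> J \<Longrightarrow> j \<in> J \<Longrightarrow> i \<noteq> j \<Longrightarrow> \<psi> i x \<noteq> \<psi> j y"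
  unfolding sunflower_def by blast

text \<open>Petals are disjoint, so each vertex of \<open>Z\<close> spoils at most one of them. If
  all were spoilt, choosing one bad position for each index would give an injection of
  \<open>J\<close> into \<open>Z\<close>.\<close>

lemma sunflower_avoid:
  assumes "sunflower J \<psi> X K" and "finite Z" and "card Z < card J"
  obtains i where "i \<in> J" "\<And>x. x \<in> X \<Longrightarrow> x \<notin> K \<Longrightarrow> \<psi> i x \<notin> Z"
proof (rule ccontr)
  assume "\<not> thesis"
  hence "\<forall>i\<in>J. \<exists>x\<in>X - K. \<psi> i x \<in> Z" using that by (metis DiffI)
  then obtain x where x: "\<And>i. i \<in> J \<Longrightarrow> x i \<in> X - K \<and> \<psi> i (x i) \<in> Z" by metis
  have "inj_on (\<lambda>i. \<psi> i (x i)) J"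
    using x sunflower_petal[OF assms(1)] by (intro inj_onI) (metis DiffE)
  hence "card J \<le> card Z"
    using x assms(2) by (intro card_inj_on_le) auto
  thus False using assms(3) by simp
qed

text \<open>Colour \<open>i < j\<close> by the coincidences between \<open>\<psi> i\<close> and \<open>\<psi> j\<close>. For three
  indices of a homogeneous set, injectivity forces every coincidence to be diagonal.\<close>

lemma ramsey_sunflower:
  fixes X :: "'x set"
  assumes "finite X"
  shows "\<exists>M. \<forall>(I::'i set) (\<psi>::'i \<Rightarrow> 'x \<Rightarrow> 'y). M \<le> card I \<longrightarrow> (\<forall>i\<in>I. inj_on (\<psi> i) X) \<longrightarrow>
    (\<exists>J\<subseteq>I. card J = m \<and> (\<exists>K. sunflower J \<psi> X K))"
proof -
  \<comment> \<open>The summand 3 provides the three indices used below, whatever \<open>m\<close>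
    is.\<close>
  obtain M where M: "ramsey_bound (Pow (X \<times> X)) (m + 3) M"
    using ramsey_bound_exists[of "Pow (X \<times> X)" "m + 3"] assms by auto
  show ?thesis
  proof (intro exI[of _ "Suc M"] allI impI)
    fix I :: "'i set" and \<psi> :: "'i \<Rightarrow> 'x \<Rightarrow> 'y"
    assume I: "Suc M \<le> card I" and inj_\<psi>: "\<forall>i\<in>I. inj_on (\<psi> i) X"
    obtain h :: "nat \<Rightarrow> 'i" where h: "inj_on h {..<Suc M}" "h ` {..<Suc M} \<subseteq> I"
      using enumerate_large_set[OF I] by auto
    define col where "col = (\<lambda>i j. {(x, y) \<in> X \<times> X. \<psi> (h i) x = \<psi> (h j) y})"
    obtain J c where J: "J \<subseteq> {..<M}" "card J = m + 3"
      and c: "\<And>i j. i \<in> J \<Longrightarrow> j \<in> J \<Longrightarrow> i < j \<Longrightarrow> col i j = c"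
      by (rule ramsey_boundE[OF M, of col]) (auto simp: col_def)
    have fJ: "finite J" using J by (auto intro: finite_subset)
    have J_I: "h i \<in> I" if "i \<in> J" for i using that J(1) h(2) by force
    have inj: "inj_on h J" by (rule inj_on_subset[OF h(1)]) (use J(1) in auto)
    obtain J3 where J3: "J3 \<subseteq> J" "card J3 = 3" "finite J3"
      using obtain_subset_with_card_n[of 3 J] J(2) by auto
    hence "J3 \<in> nsets J 3" by (simp add: nsets_def)
    then obtain p q r where pqr: "p \<in> J" "q \<in> J" "r \<in> J" "p < q" "q < r"
      unfolding ordered_nsets_3_eq by blast
    have mem: "(x, y) \<in> c \<longleftrightarrow> x \<in> X \<and> y \<in> X \<and> \<psi> (h i) x = \<psi> (h j) y"
      if "i \<in> J" "j \<in> J" "i < j" for i j x y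
      using c[OF that] by (auto simp: col_def)
    \<comment> \<open>The middle index decides: \<psi> (h q) x = \<psi> (h r) y = \<psi> (h p) x =
      \<psi> (h q) y.\<close>
    have diag: "x = y" if "(x, y) \<in> c" for x y
    proof -
      have "x \<in> X" "y \<in> X" "\<psi> (h p) x = \<psi> (h q) y" "\<psi> (h p) x = \<psi> (h r) y" "\<psi> (h q) x = \<psi> (h r) y"
        using mem[of p q x y] mem[of p r x y] mem[of q r x y] pqr that by auto
      thus ?thesis using inj_\<psi> J_I[OF pqr(2)] by (metis inj_on_def)
    qed
    define K where "K = {x \<in> X. (x, x) \<in> c}"
    obtain J' where J': "J' \<subseteq> J" "card J' = m"
      using J(2) obtain_subset_with_card_n[of m J] by auto
    have "sunflower (h ` J') \<psi> X K"
      unfolding sunflower_def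
    proof (intro conjI ballI impI)
      show "K \<subseteq> X" by (auto simp: K_def)
      fix x a b assume x: "x \<in> K" and "a \<in> h ` J'" "b \<in> h ` J'"
      then obtain i j where "i \<in> J" "j \<in> J" "a = h i" "b = h j" using J' by blast
      thus "\<psi> a x = \<psi> b x"
        using x mem[of i j x x] mem[of j i x x] by (cases i j rule: linorder_cases) (auto simp: K_def)
    next
      fix a b x y assume "a \<in> h ` J'" "b \<in> h ` J'" "a \<noteq> b" and x: "x \<in> X - K" "y \<in> X"
      then obtain i j where ij: "i \<in> J" "j \<in> J" "a = h i" "b = h j" "i \<noteq> j" using J' by blast
      show "\<psi> a x \<noteq> \<psi> b y"
      proof
        assume eq: "\<psi> a x = \<psi> b y"
        have "(x, y) \<in> c \<or> (y, x) \<in> c"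
          using ij x eq mem[of i j x y] mem[of j i y x] by (cases i j rule: linorder_cases) auto
        thus False using diag x by (auto simp: K_def)
      qed
    qed
    moreover have "card (h ` J') = m" using J' inj by (metis card_image inj_on_subset)
    moreover have "h ` J' \<subseteq> I" using J' J_I by auto
    ultimately show "\<exists>J\<subseteq>I. card J = m \<and> (\<exists>K. sunflower J \<psi> X K)" by blast
  qed
qed

section \<open>Embeddings and the bootstrap step\<close>

definition embedding :: "'a hypergraph \<Rightarrow> 'b hypergraph \<Rightarrow> ('a \<Rightarrow> 'b) \<Rightarrow> bool" where
  "embedding F H \<psi> \<longleftrightarrow> inj_on \<psi> (verts F) \<and> \<psi> ` verts F \<subseteq> verts H \<and> (\<forall>e\<in>edges F. \<psi> ` e \<in> edges H)"

lemma verts_add_edge [simp]: "verts (add_edge H g) = verts H"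
  and edges_add_edge [simp]: "edges (add_edge H g) = insert g (edges H)"
  by (simp_all add: add_edge_def)

lemma verts_bootstrap_step [simp]: "verts (bootstrap_step k F H) = verts H"
  by (simp add: bootstrap_step_def)

lemma embedding_mono:
  "embedding F H \<psi> \<Longrightarrow> verts H \<subseteq> verts H' \<Longrightarrow> edges H \<subseteq> edges H' \<Longrightarrow> embedding F H' \<psi>"
  unfolding embedding_def by blast

lemma copy_of_embedding:
  assumes "edges F \<subseteq> Pow (verts F)" and "embedding F H \<psi>"
  shows "Hypergraph (\<psi> ` verts F) ((`) \<psi> ` edges F) \<in> copies F H"
  using assms unfolding copies_def subhypergraph_def isomorphic_def embedding_def bij_betw_def
  by auto

lemma embedding_of_copy:
  assumes "S \<in> copies F H"
  obtains \<psi> where "embedding F H \<psi>" "verts S = \<psi> ` verts F" "edges S = (`) \<psi> ` edges F"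
proof -
  obtain \<psi> where \<psi>: "bij_betw \<psi> (verts F) (verts S)" "edges S = (`) \<psi> ` edges F"
    using assms unfolding copies_def isomorphic_def by blast
  moreover have "embedding F H \<psi>"
    using assms \<psi> by (auto simp: embedding_def copies_def subhypergraph_def bij_betw_def)
  ultimately show thesis using that by (auto simp: bij_betw_def)
qed

lemma finite_copies:
  assumes "k_graph k H"
  shows "finite (copies F H)"
proof (rule finite_subset)
  show "copies F H \<subseteq> (\<lambda>(V, E). Hypergraph V E) ` (Pow (verts H) \<times> Pow (edges H))"
  proof
    fix S assume "S \<in> copies F H"
    thus "S \<in> (\<lambda>(V, E). Hypergraph V E) ` (Pow (verts H) \<times> Pow (edges H))"
      by (cases S) (auto simp: copies_def subhypergraph_def)
  qed
  have "finite (edges H)"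
    using assms finite_imp_finite_nsets finite_subset unfolding k_graph_def by metis
  thus "finite ((\<lambda>(V, E). Hypergraph V E) ` (Pow (verts H) \<times> Pow (edges H)))"
    using assms by (simp add: k_graph_def)
qed

lemma k_graph_add_edge: "k_graph k H \<Longrightarrow> g \<in> nsets (verts H) k \<Longrightarrow> k_graph k (add_edge H g)"
  by (simp add: k_graph_def)

lemma copies_mono: "copies F H \<subseteq> copies F (add_edge H g)"
  by (auto simp: copies_def subhypergraph_def)

text \<open>Adding an edge destroys no copy, and a copy through a non-edge \<open>g\<close> is new.
  Since there are finitely many copies, strict inclusion of the sets of copies gives a strict
  increase of \<open>num_copies\<close>.\<close>

lemma bootstrap_step_new_edge:
  assumes "k_graph k H" and "edges F \<subseteq> Pow (verts F)" and g: "g \<in> nsets (verts H) k"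
    and emb: "embedding F (add_edge H g) \<psi>" and "f \<in> edges F" and "g = \<psi> ` f"
  shows "g \<in> edges (bootstrap_step k F H)"
proof (cases "g \<in> edges H")
  case False
  let ?S = "Hypergraph (\<psi> ` verts F) ((`) \<psi> ` edges F)"
  have "?S \<in> copies F (add_edge H g)" by (rule copy_of_embedding[OF assms(2) emb])
  moreover have "?S \<notin> copies F H"
    using False assms(5,6) by (auto simp: copies_def subhypergraph_def)
  ultimately have "copies F H \<subset> copies F (add_edge H g)" using copies_mono by blast
  hence "num_copies F H < num_copies F (add_edge H g)"
    unfolding num_copies_def
    using psubset_card_mono finite_copies k_graph_add_edge[OF assms(1) g] by metis
  thus ?thesis using g by (simp add: bootstrap_step_def)
qed (simp add: bootstrap_step_def)

lemma edges_bootstrap_step: "edges H \<subseteq> edges (bootstrap_step k F H)"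
  by (auto simp: bootstrap_step_def)

lemma k_graph_bootstrap_step: "k_graph k H \<Longrightarrow> k_graph k (bootstrap_step k F H)"
  by (auto simp: bootstrap_step_def k_graph_def)

text \<open>The stopping criterion. A new edge \<open>g\<close> would come with a new copy in
  \<open>add_edge H g\<close>, which lies inside the next hypergraph. By assumption the embedding of
  this copy already lives in \<open>H\<close>, so the copy is not new.\<close>

lemma bootstrap_step_fixed:
  assumes "\<And>\<psi>. embedding F (bootstrap_step k F H) \<psi> \<Longrightarrow> embedding F H \<psi>"
  shows "bootstrap_step k F H = H"
proof (rule ccontr)
  assume "bootstrap_step k F H \<noteq> H"
  hence "edges (bootstrap_step k F H) \<noteq> edges H"
    by (metis hypergraph.expand verts_bootstrap_step)
  then obtain g where g: "g \<in> edges (bootstrap_step k F H)" "g \<notin> edges H"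
    using edges_bootstrap_step by blast
  hence "num_copies F (add_edge H g) > num_copies F H" by (auto simp: bootstrap_step_def)
  hence "copies F (add_edge H g) \<noteq> copies F H" by (auto simp: num_copies_def)
  then obtain S where S: "S \<in> copies F (add_edge H g)" "S \<notin> copies F H"
    using copies_mono by blast
  obtain \<psi> where \<psi>: "embedding F (add_edge H g) \<psi>" "verts S = \<psi> ` verts F" "edges S = (`) \<psi> ` edges F"
    using S(1) by (rule embedding_of_copy)
  have "embedding F (bootstrap_step k F H) \<psi>"
    using \<psi>(1) by (rule embedding_mono) (use g edges_bootstrap_step[of H k F] in auto)
  hence "embedding F H \<psi>" by (rule assms)
  hence "S \<in> copies F H"
    using S(1) \<psi> by (auto simp: copies_def subhypergraph_def embedding_def)
  thus False using S(2) by blast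
qed

section \<open>Finite choice and counting\<close>

lemma nsets_superset_avoiding:
  assumes "finite V" and "s \<subseteq> V" and "card s \<le> k" and "finite Z" and "Z \<inter> s = {}"
    and "card Z + k \<le> card V"
  obtains g where "g \<in> nsets V k" "s \<subseteq> g" "g \<inter> Z = {}"
proof -
  have fs: "finite s" using assms(1,2) finite_subset by blast
  have "card V - card Z \<le> card (V - Z)"
    by (rule diff_card_le_card_Diff[OF assms(4)])
  moreover have "card (V - Z) = card (V - Z - s) + card s"
    using assms(1,2,5) fs by (subst card_Diff_subset) (auto intro!: le_add_diff_inverse2[symmetric] card_mono)
  ultimately have "k - card s \<le> card (V - Z - s)"
    using assms(3,6) by linarith
  then obtain T where T: "T \<subseteq> V - Z - s" "card T = k - card s" "finite T"
    using obtain_subset_with_card_n by metis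
  have "card (s \<union> T) = k"
    using T fs assms(3) by (subst card_Un_disjoint) auto
  hence "s \<union> T \<in> nsets V k" using T fs assms(2) by (auto simp: nsets_def)
  moreover have "(s \<union> T) \<inter> Z = {}" using T assms(5) by blast
  ultimately show thesis using that by blast
qed

lemma card_UN_le_mult:
  assumes "finite I" and "\<And>i. i \<in> I \<Longrightarrow> card (A i) \<le> c"
  shows "card (\<Union>i\<in>I. A i) \<le> c * card I"
proof -
  have "card (\<Union>i\<in>I. A i) \<le> (\<Sum>i\<in>I. card (A i))" by (rule card_UN_le[OF assms(1)])
  also have "\<dots> \<le> card I * c" using sum_bounded_above[of I "\<lambda>i. card (A i)" c] assms(2) by simp
  finally show ?thesis by (simp add: mult.commute)
qed

lemma inj_on_extend_into:
  fixes \<phi> :: "'x \<Rightarrow> 'y"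
  assumes "finite X" and "X0 \<subseteq> X" and "inj_on \<phi> X0" and "finite Y"
    and "card X \<le> card Y + card X0" and "\<phi> ` X0 \<inter> Y = {}"
  shows "\<exists>\<theta>. inj_on \<theta> X \<and> (\<forall>x\<in>X0. \<theta> x = \<phi> x) \<and> \<theta> ` (X - X0) \<subseteq> Y"
proof -
  have "card (X - X0) \<le> card Y"
    using assms by (subst card_Diff_subset) (auto intro: finite_subset)
  then obtain \<eta> where \<eta>: "inj_on \<eta> (X - X0)" "\<eta> ` (X - X0) \<subseteq> Y"
    using assms(1,4) card_le_inj[of "X - X0" Y] by auto
  let ?\<theta> = "\<lambda>x. if x \<in> X0 then \<phi> x else \<eta> x"
  have "inj_on ?\<theta> X"
  proof (rule inj_onI)
    fix x y assume "x \<in> X" "y \<in> X" "?\<theta> x = ?\<theta> y"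
    moreover have "\<phi> u \<noteq> \<eta> w" if "u \<in> X0" "w \<in> X - X0" for u w
    proof
      assume "\<phi> u = \<eta> w"
      moreover have "\<phi> u \<in> \<phi> ` X0" "\<eta> w \<in> Y" using that \<eta>(2) by auto
      ultimately show False using assms(6) by auto
    qed
    ultimately show "x = y" using assms(3) \<eta>(1) by (auto simp: inj_on_def split: if_splits) metis+
  qed
  thus ?thesis using \<eta>(2) by (intro exI[of _ ?\<theta>]) auto
qed

lemma Int_eq_between: "t \<inter> B = D \<Longrightarrow> C \<subseteq> B \<Longrightarrow> D \<subseteq> C \<Longrightarrow> t \<inter> C = D"
  by blast

section \<open>Flexible sets\<close>

text \<open>The edgeless case is settled directly in \<open>theorem1p1\<close>. With an edge
  present, \<open>room\<close> is at least \<open>k\<close>.\<close>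

locale extension_percolation =
  fixes k :: nat and G :: "'a hypergraph"
  assumes k3: "3 \<le> k" and G: "k_graph 2 G" and G_edge: "edges G \<noteq> {}"
begin

abbreviation F where "F \<equiv> k_extension k G"

abbreviation step :: "nat hypergraph \<Rightarrow> nat hypergraph" where "step \<equiv> bootstrap_step k F"

text \<open>One share for the core, and two shares of \<open>k\<close> vertices for each edge of
  \<open>G\<close>: one for the sets reserved in advance, one for the hyperedges already chosen.
  This also bounds the number of vertices of \<open>F\<close>.\<close>

definition room :: nat where "room = card (verts G) + 2 * k * card (edges G)"

lemma finite_G: "finite (verts G)" "finite (edges G)"
  using G finite_imp_finite_nsets finite_subset unfolding k_graph_def by metis+

lemma edge_G: assumes "e \<in> edges G" shows "e \<subseteq> verts G" "card e = 2"
  using G assms by (auto simp: k_graph_def nsets_def)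

lemma edge_G_pair:
  assumes "e \<in> edges G"
  obtains a b where "e = {a, b}" "a \<noteq> b" "a \<in> verts G" "b \<in> verts G"
  using edge_G[OF assms] by (auto simp: card_2_iff)

lemma verts_F: "verts F = Inl ` verts G \<union> Inr ` (edges G \<times> {1..k - 2})"
  and edges_F: "edges F = extension_edge k ` edges G"
  by (simp_all add: k_extension_def)

lemma edges_F_Pow: "edges F \<subseteq> Pow (verts F)"
  using edge_G(1) by (auto simp: verts_F edges_F extension_edge_def)

lemma finite_F: "finite (verts F)"
  using finite_G by (simp add: verts_F)

lemma card_G_pos: "card (edges G) \<ge> 1"
  using G_edge finite_G by (simp add: Suc_le_eq card_gt_0_iff)

lemma card_F_le: "card (verts F) \<le> room"
proof -
  have "card (verts F) \<le> card (Inl ` verts G :: ('a + 'a set \<times> nat) set) + card (Inr ` (edges G \<times> {1..k - 2}) :: ('a + 'a set \<times> nat) set)"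
    unfolding verts_F by (rule card_Un_le)
  also have "\<dots> = card (verts G) + card (edges G) * (k - 2)"
    by (simp add: card_image card_cartesian_product)
  also have "card (edges G) * (k - 2) \<le> card (edges G) * (2 * k)" by (rule mult_le_mono2) simp
  finally show ?thesis by (simp add: room_def mult.commute)
qed

lemma k_le_room: "k \<le> room"
proof -
  have "k * 1 \<le> k * card (edges G)" using card_G_pos by (rule mult_le_mono2)
  thus ?thesis unfolding room_def by linarith
qed

text \<open>The \<open>k - 2\<close> private vertices of an edge are interchangeable, so any
  bijection onto \<open>f e\<close> minus its core pair completes the copy. Distinct hyperedges meet
  only in the core, which makes the resulting map injective.\<close>

lemma embedding_of_edges:
  assumes H: "k_graph k H" and \<phi>: "inj_on \<phi> (verts G)" "\<phi> ` verts G \<subseteq> verts H"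
    and f: "\<And>e. e \<in> edges G \<Longrightarrow> f e \<in> edges H"
    and core: "\<And>e. e \<in> edges G \<Longrightarrow> f e \<inter> \<phi> ` verts G = \<phi> ` e"
    and disj: "\<And>e e'. e \<in> edges G \<Longrightarrow> e' \<in> edges G \<Longrightarrow> e \<noteq> e' \<Longrightarrow> f e \<inter> f e' \<subseteq> \<phi> ` verts G"
  obtains \<psi> where "embedding F H \<psi>" "\<And>x. \<psi> (Inl x) = \<phi> x"
    "\<And>e. e \<in> edges G \<Longrightarrow> \<psi> ` extension_edge k e = f e"
proof -
  have "\<exists>\<beta>. bij_betw \<beta> {1..k - 2} (f e - \<phi> ` e)" if "e \<in> edges G" for e
  proof -
    have "finite (f e)" "card (f e) = k"
      using f[OF that] H by (auto simp: k_graph_def nsets_def)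
    moreover have "\<phi> ` e \<subseteq> f e" using core[OF that] by blast
    moreover have "card (\<phi> ` e) = 2"
      using edge_G[OF that] \<phi>(1) by (metis card_image inj_on_subset)
    ultimately have "finite (f e - \<phi> ` e)" "card (f e - \<phi> ` e) = k - 2"
      by (simp_all add: card_Diff_subset finite_subset)
    thus ?thesis using bij_betw_iff_card[of "{1..k - 2}" "f e - \<phi> ` e"] by auto
  qed
  then obtain \<beta> where \<beta>: "\<And>e. e \<in> edges G \<Longrightarrow> bij_betw (\<beta> e) {1..k - 2} (f e - \<phi> ` e)"
    by metis
  define \<psi> where "\<psi> = case_sum \<phi> (\<lambda>(e, i). \<beta> e i)"
  have priv: "\<beta> e i \<in> f e" "\<beta> e i \<notin> \<phi> ` verts G" if "e \<in> edges G" "i \<in> {1..k - 2}" for e i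
    using bij_betwE[OF \<beta>[OF that(1)]] that core[OF that(1)] by blast+
  have img: "\<psi> ` extension_edge k e = f e" if "e \<in> edges G" for e
  proof -
    have "\<psi> ` extension_edge k e = \<phi> ` e \<union> \<beta> e ` {1..k - 2}"
      by (simp add: \<psi>_def extension_edge_def image_Un image_image)
    also have "\<dots> = f e"
      using \<beta>[OF that] core[OF that] by (auto simp: bij_betw_def)
    finally show ?thesis .
  qed
  have "inj_on \<psi> (verts F)"
  proof (rule inj_onI)
    fix x y assume "x \<in> verts F" "y \<in> verts F" and eq: "\<psi> x = \<psi> y"
    then consider a b where "x = Inl a" "y = Inl b" "a \<in> verts G" "b \<in> verts G"
      | a e i where "x = Inl a" "y = Inr (e, i)" "a \<in> verts G" "e \<in> edges G" "i \<in> {1..k - 2}"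
      | a e i where "y = Inl a" "x = Inr (e, i)" "a \<in> verts G" "e \<in> edges G" "i \<in> {1..k - 2}"
      | e i e' i' where "x = Inr (e, i)" "y = Inr (e', i')" "e \<in> edges G" "i \<in> {1..k - 2}"
          "e' \<in> edges G" "i' \<in> {1..k - 2}"
      unfolding verts_F by blast
    thus "x = y"
    proof cases
      case 1 thus ?thesis using eq \<phi>(1) by (auto simp: \<psi>_def inj_on_def)
    next
      case 2
      hence "\<beta> e i = \<phi> a" using eq by (simp add: \<psi>_def)
      thus ?thesis using priv(2)[OF 2(4,5)] 2(3) by blast
    next
      case 3
      hence "\<beta> e i = \<phi> a" using eq by (simp add: \<psi>_def)
      thus ?thesis using priv(2)[OF 3(4,5)] 3(3) by blast
    next
      case 4
      hence eq': "\<beta> e i = \<beta> e' i'" using eq by (simp add: \<psi>_def)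
      hence "e = e'"
        using disj[OF 4(3,5)] priv[OF 4(3,4)] priv[OF 4(5,6)] by auto
      moreover from this have "i = i'"
        using \<beta>[OF 4(3)] eq' 4(4,6) by (auto simp: bij_betw_def inj_on_def)
      ultimately show ?thesis using 4 by simp
    qed
  qed
  moreover have "\<psi> ` verts F \<subseteq> verts H"
  proof -
    have "f e \<subseteq> verts H" if "e \<in> edges G" for e
      using f[OF that] H by (auto simp: k_graph_def nsets_def)
    hence "\<beta> e i \<in> verts H" if "e \<in> edges G" "i \<in> {1..k - 2}" for e i
      using priv(1)[OF that] that by blast
    thus ?thesis using \<phi>(2) by (auto simp: verts_F \<psi>_def)
  qed
  ultimately have "embedding F H \<psi>"
    using f img by (auto simp: embedding_def edges_F)
  thus thesis using that[of \<psi>] img by (simp add: \<psi>_def)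
qed

text \<open>Requiring \<open>Z\<close> to be disjoint from \<open>s\<close> makes every edge of
  \<open>H\<close> flexible, so hyperedges already present and pairs that can be extended in many
  ways are handled alike.\<close>

definition flex :: "nat hypergraph \<Rightarrow> nat set \<Rightarrow> bool" where
  "flex H s \<longleftrightarrow> (\<forall>Z. finite Z \<and> card Z \<le> room \<and> Z \<inter> s = {} \<longrightarrow> (\<exists>g\<in>edges H. s \<subseteq> g \<and> g \<inter> Z = {}))"

lemma flexE:
  assumes "flex H s" and "finite Z" and "card Z \<le> room" and "Z \<inter> s = {}"
  obtains g where "g \<in> edges H" "s \<subseteq> g" "g \<inter> Z = {}"
  using assms unfolding flex_def by blast

lemma flex_mono: "flex H s \<Longrightarrow> edges H \<subseteq> edges H' \<Longrightarrow> flex H' s"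
  unfolding flex_def by (meson subsetD)

lemma flex_edge: "g \<in> edges H \<Longrightarrow> flex H g"
  unfolding flex_def by (metis Int_commute order_refl)

lemma flex_card:
  assumes "k_graph k H" and "flex H s"
  shows "finite s" "card s \<le> k" "s \<subseteq> verts H"
proof -
  obtain g where "g \<in> edges H" "s \<subseteq> g"
    using flexE[OF assms(2), of "{}"] by auto
  moreover from this have "g \<subseteq> verts H" "finite g" "card g = k"
    using assms(1) by (auto simp: k_graph_def nsets_def)
  ultimately show "finite s" "card s \<le> k" "s \<subseteq> verts H"
    using finite_subset card_mono by blast+
qed

text \<open>The sets \<open>s e\<close> may reserve private vertices in advance; \<open>room\<close> is chosen so that the edges
  of the copy can be picked greedily around everything reserved or already used.\<close>

lemma embedding_of_flex:
  assumes H: "k_graph k H" and \<phi>: "inj_on \<phi> (verts G)" "\<phi> ` verts G \<subseteq> verts H"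
    and core: "\<And>e. e \<in> edges G \<Longrightarrow> s e \<inter> \<phi> ` verts G = \<phi> ` e"
    and disj: "\<And>e e'. e \<in> edges G \<Longrightarrow> e' \<in> edges G \<Longrightarrow> e \<noteq> e' \<Longrightarrow> s e \<inter> s e' \<subseteq> \<phi> ` verts G"
    and flex: "\<And>e. e \<in> edges G \<Longrightarrow> flex H (s e)"
  obtains \<psi> where "embedding F H \<psi>" "\<And>x. \<psi> (Inl x) = \<phi> x"
    "\<And>e. e \<in> edges G \<Longrightarrow> s e \<subseteq> \<psi> ` extension_edge k e"
proof -
  \<comment> \<open>The last clause keeps the chosen hyperedges clear of the sets reserved for edges
    not yet treated.\<close>
  let ?good = "\<lambda>D f. (\<forall>e\<in>D. f e \<in> edges H \<and> s e \<subseteq> f e \<and> f e \<inter> \<phi> ` verts G = \<phi> ` e \<and>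
      (\<forall>e'\<in>D. e \<noteq> e' \<longrightarrow> f e \<inter> f e' \<subseteq> \<phi> ` verts G) \<and>
      (\<forall>e'\<in>edges G. e \<noteq> e' \<longrightarrow> f e \<inter> s e' \<subseteq> \<phi> ` verts G))"
  have greedy: "\<exists>f. ?good D f" if "finite D" "D \<subseteq> edges G" for D
    using that
  proof (induction D rule: finite_induct)
    case (insert e0 D)
    then obtain f where f: "?good D f" by auto
    have e0: "e0 \<in> edges G" and D: "D \<subseteq> edges G" using insert.prems by auto
    have f_edge: "finite (f e)" "card (f e) = k" if "e \<in> D" for e
      using f that H by (auto simp: k_graph_def nsets_def)
    \<comment> \<open>Everything to be avoided, except \<open>s e0\<close>, which the new hyperedge
      has to contain. The three parts of the union have at most \<open>room\<close> vertices
      together.\<close>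
    define Z where "Z = (\<phi> ` verts G \<union> (\<Union>e\<in>D. f e) \<union> (\<Union>e\<in>edges G. s e)) - s e0"
    have fin: "finite (\<phi> ` verts G \<union> (\<Union>e\<in>D. f e) \<union> (\<Union>e\<in>edges G. s e))"
      using finite_G insert.hyps(1) f_edge(1) flex_card(1)[OF H flex] by blast
    have "card Z \<le> card (\<phi> ` verts G \<union> (\<Union>e\<in>D. f e) \<union> (\<Union>e\<in>edges G. s e))"
      unfolding Z_def by (rule card_mono[OF fin]) blast
    also have "\<dots> \<le> card (\<phi> ` verts G \<union> (\<Union>e\<in>D. f e)) + card (\<Union>e\<in>edges G. s e)" by (rule card_Un_le)
    also have "card (\<phi> ` verts G \<union> (\<Union>e\<in>D. f e)) \<le> card (\<phi> ` verts G) + card (\<Union>e\<in>D. f e)" by (rule card_Un_le)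
    also have "card (\<phi> ` verts G) \<le> card (verts G)" by (rule card_image_le[OF finite_G(1)])
    also have "card (\<Union>e\<in>D. f e) \<le> k * card D"
      using insert.hyps(1) f_edge(2) by (intro card_UN_le_mult) auto
    also have "card D \<le> card (edges G)" by (rule card_mono[OF finite_G(2) D])
    also have "card (\<Union>e\<in>edges G. s e) \<le> k * card (edges G)"
      using finite_G(2) flex_card(2)[OF H flex] by (intro card_UN_le_mult) auto
    finally have "card Z \<le> room" by (simp add: room_def)
    moreover have "finite Z" "Z \<inter> s e0 = {}" using fin by (auto simp: Z_def)
    ultimately obtain g where g: "g \<in> edges H" "s e0 \<subseteq> g" "g \<inter> Z = {}"
      using flexE[OF flex[OF e0]] by metis
    have g_core: "g \<inter> \<phi> ` verts G = \<phi> ` e0"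
      using g core[OF e0] unfolding Z_def by blast
    have g_f: "g \<inter> f e \<subseteq> \<phi> ` verts G" if "e \<in> D" for e
    proof -
      have "g \<inter> f e \<subseteq> s e0 \<inter> f e" using g that by (auto simp: Z_def)
      moreover have "e \<noteq> e0" using that insert.hyps(2) by blast
      ultimately show ?thesis using f that e0 by blast
    qed
    have g_s: "g \<inter> s e \<subseteq> \<phi> ` verts G" if "e \<in> edges G" "e0 \<noteq> e" for e
    proof -
      have "g \<inter> s e \<subseteq> s e0 \<inter> s e" using g that by (auto simp: Z_def)
      thus ?thesis using disj[OF e0 that] by blast
    qed
    have "?good (insert e0 D) (f(e0 := g))"
    proof (intro ballI conjI impI)
      fix e e' assume "e \<in> insert e0 D" "e' \<in> insert e0 D" "e \<noteq> e'"
      thus "(f(e0 := g)) e \<inter> (f(e0 := g)) e' \<subseteq> \<phi> ` verts G"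
        using f g_f[of e] g_f[of e'] by (auto split: if_splits) blast+
    next
      fix e e' assume "e \<in> insert e0 D" "e' \<in> edges G" "e \<noteq> e'"
      thus "(f(e0 := g)) e \<inter> s e' \<subseteq> \<phi> ` verts G"
        using f g_s[of e'] by (cases "e = e0") auto
    next
      fix e assume "e \<in> insert e0 D"
      hence "e \<in> D" if "e \<noteq> e0" using that by blast
      thus "(f(e0 := g)) e \<in> edges H" "s e \<subseteq> (f(e0 := g)) e"
        "(f(e0 := g)) e \<inter> \<phi> ` verts G = \<phi> ` e"
        using f g(1,2) g_core by (cases "e = e0"; simp)+
    qed
    thus ?case by blast
  qed auto
  from greedy[OF finite_G(2) order_refl] obtain f where f: "?good (edges G) f" ..
  obtain \<psi> where "embedding F H \<psi>" "\<And>x. \<psi> (Inl x) = \<phi> x"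
    "\<And>e. e \<in> edges G \<Longrightarrow> \<psi> ` extension_edge k e = f e"
    by (rule embedding_of_edges[OF H \<phi>, of f]) (use f in \<open>simp_all add: f\<close>)
  thus thesis using that[of \<psi>] f by simp
qed

lemma k_graph_step: "k_graph k H \<Longrightarrow> k_graph k (step H)"
  by (rule k_graph_bootstrap_step)

lemma flex_step: "flex H s \<Longrightarrow> flex (step H) s"
  using flex_mono edges_bootstrap_step by blast

text \<open>Add the \<open>k\<close>-set \<open>s e0\<close> as an edge, so that all sets
  \<open>s e\<close> become flexible. In the copy given by \<open>embedding_of_flex\<close> the
  hyperedge over \<open>e0\<close> contains \<open>s e0\<close> and also has \<open>k\<close>
  vertices, so the copy uses the added edge.\<close>

lemma step_edgeI:
  assumes H: "k_graph k H" and \<phi>: "inj_on \<phi> (verts G)" "\<phi> ` verts G \<subseteq> verts H"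
    and core: "\<And>e. e \<in> edges G \<Longrightarrow> s e \<inter> \<phi> ` verts G = \<phi> ` e"
    and disj: "\<And>e e'. e \<in> edges G \<Longrightarrow> e' \<in> edges G \<Longrightarrow> e \<noteq> e' \<Longrightarrow> s e \<inter> s e' \<subseteq> \<phi> ` verts G"
    and flex: "\<And>e. e \<in> edges G \<Longrightarrow> e \<noteq> e0 \<Longrightarrow> flex H (s e)"
    and e0: "e0 \<in> edges G" and g: "s e0 \<in> nsets (verts H) k"
  shows "s e0 \<in> edges (step H)"
proof -
  let ?H' = "add_edge H (s e0)"
  have H': "k_graph k ?H'" using H g by (rule k_graph_add_edge)
  have flex': "flex ?H' (s e)" if "e \<in> edges G" for e
    using flex[OF that] flex_edge[of "s e0" ?H'] flex_mono[of H "s e" ?H'] by auto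
  obtain \<psi> where \<psi>: "embedding F ?H' \<psi>" "\<And>e. e \<in> edges G \<Longrightarrow> s e \<subseteq> \<psi> ` extension_edge k e"
    by (rule embedding_of_flex[OF H' \<phi>(1) _ core disj flex']) (use \<phi>(2) in auto)
  have "\<psi> ` extension_edge k e0 \<in> edges ?H'"
    using \<psi>(1) e0 by (auto simp: embedding_def edges_F)
  hence "finite (\<psi> ` extension_edge k e0)" "card (\<psi> ` extension_edge k e0) = k"
    using H' by (auto simp: k_graph_def nsets_def)
  hence "s e0 = \<psi> ` extension_edge k e0"
    using \<psi>(2)[OF e0] g by (intro card_subset_eq) (auto simp: nsets_def)
  thus ?thesis
    by (intro bootstrap_step_new_edge[OF H edges_F_Pow g \<psi>(1), of "extension_edge k e0"])
       (use e0 in \<open>auto simp: edges_F\<close>)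
qed

text \<open>Given \<open>Z\<close>, enlarge \<open>s e0\<close> to a \<open>k\<close>-set
  \<open>g\<close> that avoids \<open>Z\<close> and all other vertices reserved for the copy, and
  apply \<open>step_edgeI\<close> to \<open>g\<close>. The host has space for \<open>Z\<close>,
  \<open>U\<close> and \<open>g\<close>, each of size at most \<open>room\<close>.\<close>

lemma step_flexI:
  assumes H: "k_graph k H" and large: "4 * room \<le> card (verts H)"
    and \<phi>: "inj_on \<phi> (verts G)" "\<phi> ` verts G \<subseteq> verts H"
    and core: "\<And>e. e \<in> edges G \<Longrightarrow> s e \<inter> \<phi> ` verts G = \<phi> ` e"
    and disj: "\<And>e e'. e \<in> edges G \<Longrightarrow> e' \<in> edges G \<Longrightarrow> e \<noteq> e' \<Longrightarrow> s e \<inter> s e' \<subseteq> \<phi> ` verts G"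
    and flex: "\<And>e. e \<in> edges G \<Longrightarrow> e \<noteq> e0 \<Longrightarrow> flex H (s e)"
    and e0: "e0 \<in> edges G" and s0: "s e0 \<subseteq> verts H" "card (s e0) \<le> k"
  shows "flex (step H) (s e0)"
  unfolding flex_def
proof (intro allI impI)
  fix Z assume Z: "finite Z \<and> card Z \<le> room \<and> Z \<inter> s e0 = {}"
  have finH: "finite (verts H)" using H by (simp add: k_graph_def)
  have fin_s: "finite (s e)" "card (s e) \<le> k" if "e \<in> edges G" for e
    using flex_card[OF H flex[OF that]] s0 finite_subset[OF s0(1) finH] by (cases "e = e0"; simp)+
  define U where "U = \<phi> ` verts G \<union> (\<Union>e\<in>edges G. s e)"
  have finU: "finite U" using finite_G fin_s by (auto simp: U_def)
  have "card U \<le> card (\<phi> ` verts G) + card (\<Union>e\<in>edges G. s e)" unfolding U_def by (rule card_Un_le)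
  also have "card (\<phi> ` verts G) \<le> card (verts G)" by (rule card_image_le[OF finite_G(1)])
  also have "card (\<Union>e\<in>edges G. s e) \<le> k * card (edges G)"
    using finite_G(2) fin_s(2) by (intro card_UN_le_mult) auto
  finally have "card U \<le> room" by (simp add: room_def)
  moreover have "card (Z \<union> (U - s e0)) \<le> card Z + card (U - s e0)" by (rule card_Un_le)
  moreover have "card (U - s e0) \<le> card U" using finU by (intro card_mono) auto
  ultimately have "card (Z \<union> (U - s e0)) + k \<le> card (verts H)"
    using Z large k_le_room by linarith
  then obtain g where g: "g \<in> nsets (verts H) k" "s e0 \<subseteq> g" "g \<inter> (Z \<union> (U - s e0)) = {}"
    using nsets_superset_avoiding[OF finH s0, of "Z \<union> (U - s e0)"] Z finU by blast
  have gU: "g \<inter> U \<subseteq> s e0" using g by blast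
  have "(s(e0 := g)) e0 \<in> edges (step H)"
  proof (rule step_edgeI[where s = "s(e0 := g)", OF H \<phi> _ _ _ e0])
    fix e assume e: "e \<in> edges G"
    show "(s(e0 := g)) e \<inter> \<phi> ` verts G = \<phi> ` e"
    proof (cases "e = e0")
      case True
      have "g \<inter> \<phi> ` verts G = s e0 \<inter> \<phi> ` verts G" using gU g(2) unfolding U_def by blast
      thus ?thesis using core[OF e] True by simp
    qed (use core[OF e] in simp)
    show "flex H ((s(e0 := g)) e)" if "e \<noteq> e0" using flex[OF e that] that by simp
    show "(s(e0 := g)) e \<inter> (s(e0 := g)) e' \<subseteq> \<phi> ` verts G" if e': "e' \<in> edges G" "e \<noteq> e'" for e'
    proof -
      have "g \<inter> s e'' \<subseteq> s e0 \<inter> s e''" if "e'' \<in> edges G" for e''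
        using gU that by (auto simp: U_def)
      moreover have "g \<inter> s e'' \<subseteq> \<phi> ` verts G" if "e'' \<in> edges G" "e'' \<noteq> e0" for e''
        using calculation[OF that(1)] disj[OF e0 that(1)] that(2) by blast
      ultimately show ?thesis
        using disj[OF e e'] e e' by (cases "e = e0"; cases "e' = e0") (simp_all add: Int_commute)
    qed
  qed (use g(1) in simp)
  thus "\<exists>g\<in>edges (step H). s e0 \<subseteq> g \<and> g \<inter> Z = {}" using g by auto
qed

section \<open>Flexible sets obtained from copies\<close>

lemma embedding_core:
  assumes "embedding F H \<psi>"
  shows "inj_on (\<lambda>x. \<psi> (Inl x)) (verts G)" "(\<lambda>x. \<psi> (Inl x)) ` verts G \<subseteq> verts H"
    and "e \<in> edges G \<Longrightarrow> \<psi> ` extension_edge k e \<inter> (\<lambda>x. \<psi> (Inl x)) ` verts G = (\<lambda>x. \<psi> (Inl x)) ` e"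
    and "e \<in> edges G \<Longrightarrow> e' \<in> edges G \<Longrightarrow> e \<noteq> e' \<Longrightarrow>
      \<psi> ` extension_edge k e \<inter> \<psi> ` extension_edge k e' \<subseteq> (\<lambda>x. \<psi> (Inl x)) ` verts G"
proof -
  have inj: "inj_on \<psi> (verts F)" and sub: "\<psi> ` verts F \<subseteq> verts H"
    using assms by (auto simp: embedding_def)
  show "inj_on (\<lambda>x. \<psi> (Inl x)) (verts G)"
    using inj by (auto simp: inj_on_def verts_F)
  show "(\<lambda>x. \<psi> (Inl x)) ` verts G \<subseteq> verts H"
    using sub by (auto simp: verts_F)
  have eF: "extension_edge k e \<subseteq> verts F" if "e \<in> edges G" for e
    using that edges_F_Pow by (auto simp: edges_F)
  have cF: "Inl ` verts G \<subseteq> verts F" by (auto simp: verts_F)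
  have im: "(\<lambda>x. \<psi> (Inl x)) ` S = \<psi> ` Inl ` S" for S by (simp add: image_image)
  show "\<psi> ` extension_edge k e \<inter> (\<lambda>x. \<psi> (Inl x)) ` verts G = (\<lambda>x. \<psi> (Inl x)) ` e" if "e \<in> edges G"
  proof -
    have "extension_edge k e \<inter> Inl ` verts G = Inl ` e"
      using edge_G(1)[OF that] by (auto simp: extension_edge_def)
    thus ?thesis unfolding im using inj_on_image_Int[OF inj eF[OF that] cF] by metis
  qed
  show "\<psi> ` extension_edge k e \<inter> \<psi> ` extension_edge k e' \<subseteq> (\<lambda>x. \<psi> (Inl x)) ` verts G"
    if "e \<in> edges G" "e' \<in> edges G" "e \<noteq> e'"
  proof -
    have "extension_edge k e \<inter> extension_edge k e' \<subseteq> Inl ` verts G"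
      using edge_G(1)[OF that(1)] that(3) by (auto simp: extension_edge_def)
    hence "\<psi> ` (extension_edge k e \<inter> extension_edge k e') \<subseteq> \<psi> ` Inl ` verts G" by (rule image_mono)
    thus ?thesis unfolding im inj_on_image_Int[OF inj eF[OF that(1)] eF[OF that(2)]] .
  qed
qed

text \<open>Replace the hyperedge over \<open>e0\<close> by \<open>t\<close> and keep the rest of
  the copy. Besides the core pair itself, \<open>t\<close> may be the core pair with one vertex
  outside the copy. Then a core vertex of the copy lies, as a private vertex, on hyperedges through
  the other two vertices.\<close>

lemma embedding_flex:
  assumes H: "k_graph k H" and large: "4 * room \<le> card (verts H)"
    and \<psi>: "embedding F H \<psi>" and e0: "e0 \<in> edges G"
    and t: "t \<subseteq> verts H" "card t \<le> k" "t \<inter> \<psi> ` verts F = (\<lambda>x. \<psi> (Inl x)) ` e0"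
  shows "flex (step H) t"
proof -
  let ?s = "\<lambda>e. if e = e0 then t else \<psi> ` extension_edge k e"
  have eF: "\<psi> ` extension_edge k e \<subseteq> \<psi> ` verts F" if "e \<in> edges G" for e
    using that edges_F_Pow by (auto simp: edges_F)
  have cF: "(\<lambda>x. \<psi> (Inl x)) ` verts G \<subseteq> \<psi> ` verts F" by (auto simp: verts_F)
  have e0G: "(\<lambda>x. \<psi> (Inl x)) ` e0 \<subseteq> (\<lambda>x. \<psi> (Inl x)) ` verts G"
    using edge_G(1)[OF e0] by blast
  have "flex (step H) (?s e0)"
  proof (rule step_flexI[where s = ?s and \<phi> = "\<lambda>x. \<psi> (Inl x)", OF H large embedding_core(1,2)[OF \<psi>] _ _ _ e0])
    fix e assume e: "e \<in> edges G"
    show "?s e \<inter> (\<lambda>x. \<psi> (Inl x)) ` verts G = (\<lambda>x. \<psi> (Inl x)) ` e"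
    proof (cases "e = e0")
      case True
      have "t \<inter> (\<lambda>x. \<psi> (Inl x)) ` verts G = (\<lambda>x. \<psi> (Inl x)) ` e0"
        by (rule Int_eq_between[OF t(3) cF e0G])
      thus ?thesis using True by simp
    qed (use embedding_core(3)[OF \<psi> e] in simp)
    show "flex H (?s e)" if "e \<noteq> e0"
      using that e \<psi> flex_edge by (auto simp: embedding_def edges_F)
    show "?s e \<inter> ?s e' \<subseteq> (\<lambda>x. \<psi> (Inl x)) ` verts G" if e': "e' \<in> edges G" "e \<noteq> e'" for e'
    proof -
      have "t \<inter> \<psi> ` extension_edge k e'' \<subseteq> (\<lambda>x. \<psi> (Inl x)) ` verts G" if "e'' \<in> edges G" for e''
      proof -
        have "t \<inter> \<psi> ` extension_edge k e'' \<subseteq> t \<inter> \<psi> ` verts F" using eF[OF that] by (rule Int_mono[OF order_refl])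
        also note t(3)
        also note e0G
        finally show ?thesis .
      qed
      from this[OF e] this[OF e'(1)] show ?thesis
        using embedding_core(4)[OF \<psi> e e'] e'(2)
        by (cases "e = e0"; cases "e' = e0") (simp_all add: Int_commute)
    qed
  qed (simp_all add: t(1,2))
  thus ?thesis by simp
qed

lemma embedding_pair_flex:
  assumes H: "k_graph k H" and large: "4 * room \<le> card (verts H)"
    and \<psi>: "embedding F H \<psi>" and e: "e \<in> edges G"
  shows "flex (step H) ((\<lambda>x. \<psi> (Inl x)) ` e)"
proof (rule embedding_flex[OF H large \<psi> e])
  have "(\<lambda>x. \<psi> (Inl x)) ` e \<subseteq> \<psi> ` verts F"
    using edge_G(1)[OF e] by (auto simp: verts_F)
  thus "(\<lambda>x. \<psi> (Inl x)) ` e \<subseteq> verts H" "(\<lambda>x. \<psi> (Inl x)) ` e \<inter> \<psi> ` verts F = (\<lambda>x. \<psi> (Inl x)) ` e"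
    using \<psi> by (simp_all add: embedding_def Int_absorb2 order_trans)
  have "card ((\<lambda>x. \<psi> (Inl x)) ` e) \<le> card e"
    using finite_subset[OF edge_G(1)[OF e] finite_G(1)] by (rule card_image_le)
  thus "card ((\<lambda>x. \<psi> (Inl x)) ` e) \<le> k" using edge_G(2)[OF e] k3 by simp
qed

section \<open>Hubs produced by sunflowers of copies\<close>

text \<open>The exceptional set \<open>B\<close> arises in \<open>hub_of_sunflower\<close> as the
  image of a kernel, hence the bound \<open>room\<close>.\<close>

definition hub :: "nat hypergraph \<Rightarrow> nat \<Rightarrow> bool" where
  "hub H h \<longleftrightarrow> h \<in> verts H \<and>
     (\<exists>B. finite B \<and> card B \<le> room \<and> (\<forall>q\<in>verts H. q \<notin> B \<longrightarrow> q \<noteq> h \<longrightarrow> flex H {h, q}))"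

lemma hub_step: "hub H h \<Longrightarrow> hub (step H) h"
  unfolding hub_def using flex_step by (metis verts_bootstrap_step)

lemma core_in_F: "a \<in> verts G \<Longrightarrow> Inl a \<in> verts F"
  by (simp add: verts_F)

lemma embedding_inj: "embedding F H \<psi> \<Longrightarrow> x \<in> verts F \<Longrightarrow> y \<in> verts F \<Longrightarrow> \<psi> x = \<psi> y \<Longrightarrow> x = y"
  by (auto simp: embedding_def inj_on_def)

lemma embedding_in: "embedding F H \<psi> \<Longrightarrow> x \<in> verts F \<Longrightarrow> \<psi> x \<in> verts H"
  by (auto simp: embedding_def)

lemma card_insert3_le: "card {x, y, z} \<le> 3"
  by (simp add: card_insert_if)

text \<open>For given \<open>q\<close> and \<open>Z\<close>, some petal avoids both. In its copy the
  core pair over \<open>{a, b}\<close> together with \<open>q\<close> is flexible, and the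
  hyperedges through this triple join the hub to \<open>q\<close>, with the image of
  \<open>b\<close> as a private vertex.\<close>

lemma hub_of_sunflower:
  assumes H: "k_graph k H" and large: "4 * room \<le> card (verts H)"
    and emb: "\<And>i. i \<in> J \<Longrightarrow> embedding F H (\<psi> i)"
    and sun: "sunflower J \<psi> (verts F) K" and J: "room + 2 \<le> card J"
    and ab: "{a, b} \<in> edges G" "Inl a \<in> K" "Inl b \<notin> K" and i0: "i0 \<in> J"
  shows "hub (step H) (\<psi> i0 (Inl a))"
proof -
  let ?h = "\<psi> i0 (Inl a)"
  have abF: "Inl a \<in> verts F" "Inl b \<in> verts F"
    using edge_G(1)[OF ab(1)] core_in_F by auto
  have KF: "K \<subseteq> verts F" using sun by (simp add: sunflower_def)
  have finK: "finite K" using KF finite_F finite_subset by blast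
  have "card (\<psi> i0 ` K) \<le> card K" using finK by (rule card_image_le)
  also have "\<dots> \<le> card (verts F)" using KF finite_F by (rule card_mono[rotated])
  also note card_F_le
  finally have card_B: "card (\<psi> i0 ` K) \<le> room" .
  have "flex (step H) {?h, q}" if q: "q \<in> verts H" "q \<notin> \<psi> i0 ` K" "q \<noteq> ?h" for q
    unfolding flex_def
  proof (intro allI impI)
    fix Z assume Z: "finite Z \<and> card Z \<le> room \<and> Z \<inter> {?h, q} = {}"
    \<comment> \<open>At most \<open>room + 1\<close> vertices are to be avoided, hence the
      \<open>room + 2\<close> members of the sunflower.\<close>
    have "card (insert q Z) < card J"
      using Z J by (simp add: card_insert_if)
    then obtain i where i: "i \<in> J" "\<And>x. x \<in> verts F \<Longrightarrow> x \<notin> K \<Longrightarrow> \<psi> i x \<notin> insert q Z"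
      using sunflower_avoid[OF sun, of "insert q Z"] Z by (metis finite_insert)
    have hi: "?h = \<psi> i (Inl a)" using sunflower_kernel[OF sun ab(2) i0 i(1)] .
    \<comment> \<open>The petal misses \<open>q\<close> by the choice of \<open>i\<close>, and the
      kernel image does not depend on \<open>i\<close>.\<close>
    have q_out: "q \<notin> \<psi> i ` verts F"
    proof
      assume "q \<in> \<psi> i ` verts F"
      then obtain x where x: "x \<in> verts F" "q = \<psi> i x" by blast
      hence "x \<in> K" using i(2)[OF x(1)] by auto
      hence "q = \<psi> i0 x" using sunflower_kernel[OF sun _ i(1) i0] x(2) by simp
      thus False using q(2) \<open>x \<in> K\<close> by blast
    qed
    let ?t = "{?h, \<psi> i (Inl b), q}"
    have "flex (step H) ?t"
    proof (rule embedding_flex[OF H large emb[OF i(1)] ab(1)])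
      show "?t \<subseteq> verts H"
        using embedding_in[OF emb[OF i(1)]] abF q(1) hi by simp
      show "card ?t \<le> k" using card_insert3_le k3 order_trans by metis
      show "?t \<inter> \<psi> i ` verts F = (\<lambda>x. \<psi> i (Inl x)) ` {a, b}"
        unfolding hi using abF q_out by auto
    qed
    moreover have "Z \<inter> ?t = {}" using Z i(2)[OF abF(2) ab(3)] by auto
    ultimately obtain g where "g \<in> edges (step H)" "?t \<subseteq> g" "g \<inter> Z = {}"
      using flexE[of "step H" ?t Z] Z by metis
    thus "\<exists>g\<in>edges (step H). {?h, q} \<subseteq> g \<and> g \<inter> Z = {}" by blast
  qed
  moreover have "?h \<in> verts H" using embedding_in[OF emb[OF i0] abF(1)] .
  ultimately show ?thesis
    unfolding hub_def verts_bootstrap_step using card_B finite_imageI[OF finK] by blast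
qed

text \<open>Move \<open>a\<close> in the copy \<open>\<psi> j\<close> to its position in the copy \<open>\<psi> i\<close>. An edge from the new
  position to a core vertex of \<open>\<psi> j\<close> outside the kernel uses the corresponding core vertex of
  \<open>\<psi> i\<close> as a private vertex.\<close>

lemma embedding_transplant:
  assumes H: "k_graph k H" and large: "4 * room \<le> card (verts H)"
    and emb: "\<And>i. i \<in> J \<Longrightarrow> embedding F H (\<psi> i)"
    and sun: "sunflower J \<psi> (verts F) K"
    and a: "a \<in> verts G" "Inl a \<notin> K" and ij: "i \<in> J" "j \<in> J" "i \<noteq> j"
  obtains \<psi>' where "embedding F (step H) \<psi>'" "\<psi>' (Inl a) = \<psi> i (Inl a)"
    "\<And>x. x \<noteq> a \<Longrightarrow> \<psi>' (Inl x) = \<psi> j (Inl x)"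
proof -
  define \<phi> where "\<phi> = (\<lambda>x. if x = a then \<psi> i (Inl a) else \<psi> j (Inl x))"
  define p where "p = (\<lambda>e. (\<lambda>c. \<psi> i (Inl c)) ` {c \<in> e. a \<in> e \<and> c \<noteq> a \<and> Inl c \<notin> K})"
  have petal: "\<psi> i x \<noteq> \<psi> j y" if "x \<in> verts F" "x \<notin> K" "y \<in> verts F" for x y
    using sunflower_petal[OF sun that ij] .
  have petal': "\<psi> j x \<noteq> \<psi> i y" if "x \<in> verts F" "x \<notin> K" "y \<in> verts F" for x y
    using sunflower_petal[OF sun that ij(2,1)] ij(3) by simp
  have aF: "Inl a \<in> verts F" using a(1) core_in_F by blast
  have inj: "inj_on \<phi> (verts G)"
  proof (rule inj_onI)
    fix x y assume xy: "x \<in> verts G" "y \<in> verts G" "\<phi> x = \<phi> y"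
    show "x = y"
      using xy(3) petal[OF aF a(2) core_in_F[OF xy(1)]] petal[OF aF a(2) core_in_F[OF xy(2)]]
        embedding_inj[OF emb[OF ij(2)] core_in_F[OF xy(1)] core_in_F[OF xy(2)]]
      by (auto simp: \<phi>_def split: if_splits)
  qed
  have sub: "\<phi> ` verts G \<subseteq> verts H"
    using embedding_in[OF emb[OF ij(1)]] embedding_in[OF emb[OF ij(2)]] core_in_F
    by (auto simp: \<phi>_def)
  have p_out: "p e \<inter> \<phi> ` verts G = {}" if e: "e \<in> edges G" for e
  proof -
    have "\<psi> i (Inl c) \<noteq> \<phi> x" if "c \<in> e" "c \<noteq> a" "Inl c \<notin> K" "x \<in> verts G" for c x
    proof -
      have cF: "Inl c \<in> verts F" using that(1) edge_G(1)[OF e] core_in_F by blast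
      show ?thesis
        using petal[OF cF that(3) core_in_F[OF that(4)]] embedding_inj[OF emb[OF ij(1)] cF aF] that(2)
        by (auto simp: \<phi>_def)
    qed
    thus ?thesis unfolding p_def by fastforce
  qed
  \<comment> \<open>A reserved vertex determines the second end of the edge at \<open>a\<close>, and
    two edges of \<open>G\<close> with the same ends coincide.\<close>
  have p_disj: "p e \<inter> p e' = {}" if e: "e \<in> edges G" "e' \<in> edges G" "e \<noteq> e'" for e e'
  proof (rule ccontr)
    assume "p e \<inter> p e' \<noteq> {}"
    then obtain c c' where c: "\<psi> i (Inl c) = \<psi> i (Inl c')" "c \<in> e" "c' \<in> e'" "a \<in> e" "a \<in> e'" "c \<noteq> a" "c' \<noteq> a"
      unfolding p_def by auto
    have "c = c'"
      using embedding_inj[OF emb[OF ij(1)] core_in_F core_in_F c(1)] c(2,3) edge_G(1) e(1,2) by blast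
    hence "{a, c} \<subseteq> e" "{a, c} \<subseteq> e'" using c by auto
    moreover have "card {a, c} = 2" using c(6) by simp
    moreover have "finite e" "finite e'" using edge_G(2) e by (auto intro: card_ge_0_finite)
    ultimately have "{a, c} = e" "{a, c} = e'"
      using edge_G(2) e card_subset_eq by metis+
    thus False using e(3) by simp
  qed
  obtain \<psi>' where \<psi>': "embedding F (step H) \<psi>'" "\<And>x. \<psi>' (Inl x) = \<phi> x"
  proof (rule embedding_of_flex[where s = "\<lambda>e. \<phi> ` e \<union> p e", OF k_graph_step[OF H] inj])
    show "\<phi> ` verts G \<subseteq> verts (step H)" using sub by simp
    fix e assume e: "e \<in> edges G"
    have eG: "\<phi> ` e \<subseteq> \<phi> ` verts G" using edge_G(1)[OF e] by (rule image_mono)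
    show "(\<phi> ` e \<union> p e) \<inter> \<phi> ` verts G = \<phi> ` e"
      using p_out[OF e] eG by (simp add: Int_Un_distrib2 Int_absorb2)
    show "(\<phi> ` e \<union> p e) \<inter> (\<phi> ` e' \<union> p e') \<subseteq> \<phi> ` verts G" if e': "e' \<in> edges G" "e \<noteq> e'" for e'
    proof -
      have "\<phi> ` e' \<subseteq> \<phi> ` verts G" using edge_G(1)[OF e'(1)] by (rule image_mono)
      thus ?thesis using p_disj[OF e e'] eG
        by (simp add: Int_Un_distrib2 Int_Un_distrib le_infI1 le_infI2)
    qed
    show "flex (step H) (\<phi> ` e \<union> p e)"
    proof (cases "a \<in> e")
      case False
      hence "\<phi> ` e = (\<lambda>x. \<psi> j (Inl x)) ` e" by (intro image_cong) (auto simp: \<phi>_def)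
      moreover have "p e = {}" using False by (simp add: p_def)
      ultimately show ?thesis using embedding_pair_flex[OF H large emb[OF ij(2)] e] by simp
    next
      case True
      then obtain c where c: "e = {a, c}" "c \<noteq> a" "c \<in> verts G"
        using edge_G_pair[OF e] by (metis insertE insert_commute singletonD)
      have cF: "Inl c \<in> verts F" using c(3) core_in_F by blast
      have \<phi>e: "\<phi> ` e = {\<psi> i (Inl a), \<psi> j (Inl c)}" using c by (auto simp: \<phi>_def)
      show ?thesis
      proof (cases "Inl c \<in> K")
        case True
        hence "\<phi> ` e \<union> p e = (\<lambda>x. \<psi> i (Inl x)) ` e"
          using \<phi>e c(1) sunflower_kernel[OF sun True ij(1,2)] by (auto simp: p_def)
        thus ?thesis using embedding_pair_flex[OF H large emb[OF ij(1)] e] by simp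
      next
        case False
        \<comment> \<open>For the copy \<psi> i this set is the core pair of \<open>e\<close> with
          one outside vertex, so \<open>embedding_flex\<close> applies. For the new copy it is the
          pair of images of \<open>a\<close> and \<open>c\<close> under \<phi>, with \<psi> i (Inl
          c) as a private vertex.\<close>
        have "{c' \<in> e. a \<in> e \<and> c' \<noteq> a \<and> Inl c' \<notin> K} = {c}"
          using c False by auto
        hence t: "\<phi> ` e \<union> p e = {\<psi> i (Inl a), \<psi> i (Inl c), \<psi> j (Inl c)}"
          using \<phi>e by (auto simp: p_def)
        have out: "\<psi> j (Inl c) \<notin> \<psi> i ` verts F"
          using petal'[OF cF False] by (metis imageE)
        show ?thesis
          unfolding t
        proof (rule embedding_flex[OF H large emb[OF ij(1)] e])
          show "{\<psi> i (Inl a), \<psi> i (Inl c), \<psi> j (Inl c)} \<subseteq> verts H"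
            using embedding_in[OF emb[OF ij(1)]] embedding_in[OF emb[OF ij(2)]] aF cF by simp
          show "card {\<psi> i (Inl a), \<psi> i (Inl c), \<psi> j (Inl c)} \<le> k"
            using card_insert3_le k3 order_trans by metis
          show "{\<psi> i (Inl a), \<psi> i (Inl c), \<psi> j (Inl c)} \<inter> \<psi> i ` verts F = (\<lambda>x. \<psi> i (Inl x)) ` e"
            using out aF cF c(1) by auto
        qed
      qed
    qed
  qed blast
  show thesis by (rule that[OF \<psi>'(1)]) (simp_all add: \<psi>'(2) \<phi>_def)
qed

text \<open>The index type is \<open>nat set\<close> because copies will be indexed by their own
  core pairs.\<close>

definition sunflower_size :: "nat \<Rightarrow> nat \<Rightarrow> bool" where
  "sunflower_size m M \<longleftrightarrow> (\<forall>(I::nat set set) (\<psi>::nat set \<Rightarrow> 'a + 'a set \<times> nat \<Rightarrow> nat).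
     M \<le> card I \<longrightarrow> (\<forall>i\<in>I. inj_on (\<psi> i) (verts F)) \<longrightarrow>
     (\<exists>J\<subseteq>I. card J = m \<and> (\<exists>K. sunflower J \<psi> (verts F) K)))"

lemma sunflower_size_exists: "\<exists>M. sunflower_size m M"
  unfolding sunflower_size_def by (rule ramsey_sunflower[OF finite_F])

lemma sunflower_sizeD:
  fixes \<psi> :: "nat set \<Rightarrow> 'a + 'a set \<times> nat \<Rightarrow> nat"
  assumes "sunflower_size m M" and "M \<le> card I" and "\<And>i. i \<in> I \<Longrightarrow> embedding F H (\<psi> i)"
  shows "\<exists>J K. J \<subseteq> I \<and> card J = m \<and> sunflower J \<psi> (verts F) K"
proof -
  have "\<forall>i\<in>I. inj_on (\<psi> i) (verts F)" using assms(3) by (simp add: embedding_def)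
  hence "\<exists>J\<subseteq>I. card J = m \<and> (\<exists>K. sunflower J \<psi> (verts F) K)"
    using assms(1,2) unfolding sunflower_size_def by simp
  thus ?thesis by metis
qed

text \<open>Fix the copy \<open>j\<close> and transplant \<open>a\<close> from every other copy. The
  resulting copies agree at \<open>b\<close> and differ at \<open>a\<close>, so any sunflower among
  them has \<open>b\<close> in the kernel and \<open>a\<close> outside, and
  \<open>hub_of_sunflower\<close> applies one step later. The strict inequality
  \<open>M < card J\<close> leaves \<open>M\<close> copies after \<open>j\<close> is
  removed.\<close>

lemma hub_of_spread_sunflower:
  fixes \<psi> :: "nat set \<Rightarrow> 'a + 'a set \<times> nat \<Rightarrow> nat"
  assumes H: "k_graph k H" and large: "4 * room \<le> card (verts H)"
    and emb: "\<And>i. i \<in> J \<Longrightarrow> embedding F H (\<psi> i)"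
    and sun: "sunflower J \<psi> (verts F) K"
    and M: "sunflower_size (room + 2) M" and J: "M < card J"
    and ab: "{a, b} \<in> edges G" "Inl a \<notin> K" and j: "j \<in> J"
  shows "hub (step (step H)) (\<psi> j (Inl b))"
proof -
  have a: "a \<in> verts G" and b: "b \<in> verts G" and "a \<noteq> b"
    using edge_G[OF ab(1)] by (auto simp: card_insert_if split: if_splits)
  have abF: "Inl a \<in> verts F" "Inl b \<in> verts F" using a b core_in_F by auto
  have "\<exists>\<psi>'. embedding F (step H) \<psi>' \<and> \<psi>' (Inl a) = \<psi> i (Inl a) \<and> \<psi>' (Inl b) = \<psi> j (Inl b)"
    if "i \<in> J - {j}" for i
  proof -
    have "i \<in> J" "i \<noteq> j" using that by auto
    show ?thesis
    proof (rule embedding_transplant[OF H large emb sun a ab(2) \<open>i \<in> J\<close> j \<open>i \<noteq> j\<close>])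
      fix \<psi>' assume "embedding F (step H) \<psi>'" "\<psi>' (Inl a) = \<psi> i (Inl a)"
        "\<And>x. x \<noteq> a \<Longrightarrow> \<psi>' (Inl x) = \<psi> j (Inl x)"
      thus ?thesis using \<open>a \<noteq> b\<close> by (intro exI[of _ \<psi>']) simp
    qed
  qed
  then obtain \<theta> where \<theta>: "\<And>i. i \<in> J - {j} \<Longrightarrow> embedding F (step H) (\<theta> i)"
    "\<And>i. i \<in> J - {j} \<Longrightarrow> \<theta> i (Inl a) = \<psi> i (Inl a)"
    "\<And>i. i \<in> J - {j} \<Longrightarrow> \<theta> i (Inl b) = \<psi> j (Inl b)"
    by metis
  have "M \<le> card (J - {j})" using J j by simp
  hence "\<exists>J' K'. J' \<subseteq> J - {j} \<and> card J' = room + 2 \<and> sunflower J' \<theta> (verts F) K'"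
    by (rule sunflower_sizeD[OF M]) (rule \<theta>(1))
  then obtain J' K' where J': "J' \<subseteq> J - {j}" "card J' = room + 2" and sun': "sunflower J' \<theta> (verts F) K'"
    by (elim exE conjE) (rule that; assumption)
  have "card J' > Suc 0" using J'(2) by simp
  then obtain p q where pq: "p \<in> J'" "q \<in> J'" "p \<noteq> q"
    by (metis card_le_Suc0_iff_eq card_gt_0_iff gr_implies_not0 leD neq0_conv)
  have pqJ: "p \<in> J - {j}" "q \<in> J - {j}" using pq J'(1) by auto
  \<comment> \<open>Two members of the new sunflower suffice to place \<open>b\<close> inside and
    \<open>a\<close> outside its kernel.\<close>
  have "Inl b \<in> K'"
    using sunflower_petal[OF sun' abF(2) _ abF(2) pq] \<theta>(3)[OF pqJ(1)] \<theta>(3)[OF pqJ(2)] by auto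
  moreover have "Inl a \<notin> K'"
  proof
    assume "Inl a \<in> K'"
    hence "\<theta> p (Inl a) = \<theta> q (Inl a)" using sunflower_kernel[OF sun' _ pq(1,2)] by blast
    hence "\<psi> p (Inl a) = \<psi> q (Inl a)" using \<theta>(2) pqJ by simp
    thus False using sunflower_petal[OF sun abF(1) ab(2) abF(1) _ _ pq(3)] pqJ by simp
  qed
  moreover have "4 * room \<le> card (verts (step H))" using large by simp
  moreover have "{b, a} \<in> edges G" using ab(1) by (simp add: insert_commute)
  ultimately have "hub (step (step H)) (\<theta> p (Inl b))"
    using J' \<theta>(1) by (intro hub_of_sunflower[OF k_graph_step[OF H] _ _ sun' _ _ _ _ pq(1)]) auto
  thus ?thesis using \<theta>(3)[OF pqJ(1)] by simp
qed

section \<open>Many hubs\<close>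

text \<open>Send the ends of one edge \<open>e0\<close> of \<open>G\<close> to \<open>x\<close> and
  \<open>y\<close>, and all other vertices of \<open>G\<close> into \<open>Y\<close>. Every other
  edge of \<open>G\<close> has an end outside \<open>e0\<close>, so its image is a flexible pair
  with an end in \<open>Y\<close>, and \<open>t\<close> takes the place of the hyperedge over
  \<open>e0\<close>.\<close>

lemma fan_flex:
  assumes H: "k_graph k H" and large: "4 * room \<le> card (verts H)"
    and xy: "x \<noteq> y" "x \<in> verts H" "y \<in> verts H" "x \<notin> Y" "y \<notin> Y"
    and Y: "Y \<subseteq> verts H" "card (verts G) \<le> card Y + 2"
    and pairs: "\<And>h q. h \<in> Y \<Longrightarrow> q \<in> Y \<union> {x, y} \<Longrightarrow> q \<noteq> h \<Longrightarrow> flex H {h, q}"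
    and t: "t \<subseteq> verts H" "t \<inter> (Y \<union> {x, y}) = {x, y}"
  shows "card t \<le> k \<Longrightarrow> flex (step H) t" "t \<in> nsets (verts H) k \<Longrightarrow> t \<in> edges (step H)"
proof -
  obtain e0 where e0: "e0 \<in> edges G" using G_edge by blast
  obtain a b where ab: "e0 = {a, b}" "a \<noteq> b" "a \<in> verts G" "b \<in> verts G" using edge_G_pair[OF e0] .
  have finY: "finite Y" using Y(1) H finite_subset by (auto simp: k_graph_def)
  have "\<exists>\<theta>. inj_on \<theta> (verts G) \<and> (\<forall>z\<in>{a, b}. \<theta> z = (if z = a then x else y)) \<and>
      \<theta> ` (verts G - {a, b}) \<subseteq> Y"
    by (rule inj_on_extend_into) (use finite_G(1) ab xy finY Y(2) in \<open>simp_all add: inj_on_def\<close>)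
  then obtain \<theta> where \<theta>: "inj_on \<theta> (verts G)" "\<forall>z\<in>{a, b}. \<theta> z = (if z = a then x else y)"
    "\<theta> ` (verts G - {a, b}) \<subseteq> Y"
    by (elim exE conjE) (rule that; assumption)
  have \<theta>_ab: "\<theta> a = x" "\<theta> b = y" using \<theta>(2) ab(2) by simp_all
  have \<theta>_Y: "\<theta> z \<in> Y" if "z \<in> verts G" "z \<notin> e0" for z using \<theta>(3) that ab(1) by blast
  have img: "\<theta> ` verts G \<subseteq> Y \<union> {x, y}" using \<theta>_Y \<theta>_ab ab(1) by blast
  have sub: "\<theta> ` verts G \<subseteq> verts H" using img Y(1) xy(2,3) by blast
  have e0_img: "\<theta> ` e0 = {x, y}" using ab(1) \<theta>_ab by simp
  have e_img: "\<theta> ` e \<subseteq> \<theta> ` verts G" if "e \<in> edges G" for e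
    using edge_G(1)[OF that] by (rule image_mono)
  have flex: "flex H (\<theta> ` e)" if e: "e \<in> edges G" "e \<noteq> e0" for e
  proof -
    have "\<not> e \<subseteq> e0"
      using card_subset_eq[of e0 e] edge_G(2) e e0 ab(1) by auto
    then obtain c where c: "c \<in> e" "c \<notin> e0" by blast
    then obtain d where d: "e = {c, d}" "c \<noteq> d" using edge_G_pair[OF e(1)] by (metis insertE insert_commute singletonD)
    have cd: "c \<in> verts G" "d \<in> verts G" using edge_G(1)[OF e(1)] d by auto
    have "\<theta> d \<noteq> \<theta> c" using \<theta>(1) cd d(2) by (metis inj_on_def)
    hence "flex H {\<theta> c, \<theta> d}" using pairs[OF \<theta>_Y[OF cd(1) c(2)], of "\<theta> d"] img cd(2) by blast
    thus ?thesis using d(1) by simp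
  qed
  let ?s = "\<lambda>e. if e = e0 then t else \<theta> ` e"
  have core: "?s e \<inter> \<theta> ` verts G = \<theta> ` e" if "e \<in> edges G" for e
  proof (cases "e = e0")
    case True
    have "t \<inter> \<theta> ` verts G = {x, y}"
      by (rule Int_eq_between[OF t(2) img]) (use e_img[OF e0] e0_img in simp)
    thus ?thesis using True e0_img by simp
  qed (use e_img[OF that] in \<open>simp add: Int_absorb2\<close>)
  have disj: "?s e \<inter> ?s e' \<subseteq> \<theta> ` verts G" if "e \<in> edges G" "e' \<in> edges G" "e \<noteq> e'" for e e'
    using e_img[OF that(1)] e_img[OF that(2)] that(3) by (cases "e = e0") (simp_all add: le_infI1 le_infI2)
  have "flex (step H) (?s e0)" if "card t \<le> k"
    by (rule step_flexI[where s = ?s and \<phi> = \<theta>, OF H large \<theta>(1) sub core disj _ e0])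
       (use flex t(1) that in simp_all)
  thus "card t \<le> k \<Longrightarrow> flex (step H) t" by simp
  have "?s e0 \<in> edges (step H)" if "t \<in> nsets (verts H) k"
    by (rule step_edgeI[where s = ?s and \<phi> = \<theta>, OF H \<theta>(1) sub core disj _ e0])
       (use flex that in simp_all)
  thus "t \<in> nsets (verts H) k \<Longrightarrow> t \<in> edges (step H)" by simp
qed

text \<open>Let \<open>Q\<close> consist of all vertices except those outside \<open>A\<close> that
  are exceptional for some hub in \<open>A\<close>. After one step any two vertices of
  \<open>Q\<close> form a flexible pair, after two steps any vertex with any other vertex of
  \<open>Q\<close>, and after three steps all \<open>k\<close>-sets are edges. Each step is one use
  of \<open>fan_flex\<close>.\<close>

lemma complete_of_flexible_hubs:
  assumes H: "k_graph k H" and large: "(room + 10) * room \<le> card (verts H)"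
    and A: "A \<subseteq> verts H" "card A = card (verts G)"
    and B: "\<And>h. h \<in> A \<Longrightarrow> finite (B h) \<and> card (B h) \<le> room"
    and flex_B: "\<And>h q. h \<in> A \<Longrightarrow> q \<in> verts H \<Longrightarrow> q \<notin> B h \<Longrightarrow> q \<noteq> h \<Longrightarrow> flex H {h, q}"
    and indep: "\<And>h h'. h \<in> A \<Longrightarrow> h' \<in> A \<Longrightarrow> h \<noteq> h' \<Longrightarrow> h \<notin> B h'"
  shows "edges (step (step (step H))) = nsets (verts H) k"
proof -
  have large4: "4 * room \<le> card (verts H)"
  proof -
    have "4 * room \<le> (room + 10) * room" by (simp add: mult_le_mono1)
    thus ?thesis using large by linarith
  qed
  have finH: "finite (verts H)" using H by (simp add: k_graph_def)
  have finA: "finite A" using A(1) finH finite_subset by blast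
  define X where "X = (\<Union>h\<in>A. B h)"
  define Q where "Q = verts H - (X - A)"
  have finX: "finite X" using finA B by (auto simp: X_def)
  have v: "card (verts G) \<le> room" by (simp add: room_def)
  have "card X \<le> room * card A" unfolding X_def by (rule card_UN_le_mult[OF finA]) (use B in blast)
  also have "\<dots> \<le> room * room" using v A(2) by simp
  finally have "card (X - A) \<le> room * room"
    using card_mono[OF finX, of "X - A"] by (simp add: Diff_subset order_trans)
  moreover have "card (verts H) - card (X - A) \<le> card Q"
    unfolding Q_def by (rule diff_card_le_card_Diff) (use finX in simp)
  \<comment> \<open>At most \<open>room * room\<close> vertices are lost, so the bound
    \<open>(room + 10) * room\<close> leaves \<open>10 * room\<close>.\<close>
  ultimately have card_Q: "10 * room \<le> card Q"
    using large by (simp add: algebra_simps)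
  have QH: "Q \<subseteq> verts H" and finQ: "finite Q" using finH by (auto simp: Q_def)
  have room3: "3 \<le> room" using k3 k_le_room by linarith
  \<comment> \<open>The bound \<open>3 + k\<close> covers both removals made below, three vertices
    in the second step and a \<open>k\<close>-set in the third.\<close>
  have card_Q_diff: "card (verts G) \<le> card (Q - T) + 2" if "finite T" "card T \<le> 3 + k" for T
  proof -
    have "card Q - card T \<le> card (Q - T)" using that(1) by (rule diff_card_le_card_Diff)
    thus ?thesis using card_Q that(2) v k_le_room room3 by linarith
  qed
  have AQ: "flex H {h, q}" if "h \<in> A" "q \<in> Q" "q \<noteq> h" for h q
  proof -
    have "q \<notin> B h" using that indep[of q h] by (auto simp: Q_def X_def)
    thus ?thesis using flex_B that QH by blast
  qed
  \<comment> \<open>Members of \<open>A\<close> stay in \<open>Q\<close> even if they lie in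
    \<open>X\<close>; by \<open>indep\<close> none is exceptional for another one.\<close>
  have A_Q: "A \<subseteq> Q" using A(1) by (auto simp: Q_def)
  have QQ: "flex (step H) {x, y}" if "x \<in> Q" "y \<in> Q" "x \<noteq> y" for x y
  proof (rule fan_flex(1)[OF H large4 that(3), of "A - {x, y}"])
    have "card A - card {x, y} \<le> card (A - {x, y})" by (rule diff_card_le_card_Diff) simp
    thus "card (verts G) \<le> card (A - {x, y}) + 2" using A(2) that(3) by simp
    show "flex H {h, q}" if "h \<in> A - {x, y}" "q \<in> A - {x, y} \<union> {x, y}" "q \<noteq> h" for h q
      using AQ[of h q] that A_Q \<open>x \<in> Q\<close> \<open>y \<in> Q\<close> by blast
    show "card {x, y} \<le> k" using that(3) k3 by simp
  qed (use that QH A(1) in auto)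
  have H1: "k_graph k (step H)" "4 * room \<le> card (verts (step H))"
    using H large4 k_graph_step by auto
  have H2: "k_graph k (step (step H))"
    using H1 k_graph_step by auto
  have VQ: "flex (step (step H)) {x, q}" if x: "x \<in> verts H" and q: "q \<in> Q" and neq: "x \<noteq> q" for x q
    unfolding flex_def
  proof (intro allI impI)
    fix Z assume Z: "finite Z \<and> card Z \<le> room \<and> Z \<inter> {x, q} = {}"
    have "card Q - card (Z \<union> {x, q}) \<le> card (Q - (Z \<union> {x, q}))"
      by (rule diff_card_le_card_Diff) (use Z in simp)
    moreover have "card (Z \<union> {x, q}) \<le> room + 2"
      using card_Un_le[of Z "{x, q}"] Z neq by simp
    ultimately have "card (Q - (Z \<union> {x, q})) > 0" using card_Q room3 by linarith
    then obtain q' where q': "q' \<in> Q" "q' \<notin> Z" "q' \<noteq> x" "q' \<noteq> q"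
      by (metis DiffD1 DiffD2 UnCI card_gt_0_iff ex_in_conv insertCI)
    \<comment> \<open>The fan is built on \<open>q\<close> and \<open>q'\<close>, with all core
      vertices in \<open>Q\<close>; \<open>x\<close> enters only as a private vertex and need not
      lie in \<open>Q\<close>.\<close>
    have "flex (step (step H)) {x, q, q'}"
    proof (rule fan_flex(1)[OF H1, of q q' "Q - {x, q, q'}"])
      show "card (verts G) \<le> card (Q - {x, q, q'}) + 2"
        by (rule card_Q_diff) (use card_insert3_le[of x q q'] in auto)
      show "flex (step H) {h, r}" if "h \<in> Q - {x, q, q'}" "r \<in> Q - {x, q, q'} \<union> {q, q'}" "r \<noteq> h" for h r
        using QQ[of h r] that q q'(1) by blast
      show "card {x, q, q'} \<le> k" using card_insert3_le k3 order_trans by metis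
    qed (use x q q' QH neq in auto)
    moreover have "Z \<inter> {x, q, q'} = {}" using Z q' by auto
    ultimately obtain g where "g \<in> edges (step (step H))" "{x, q, q'} \<subseteq> g" "g \<inter> Z = {}"
      using flexE[of "step (step H)" "{x, q, q'}" Z] Z by metis
    thus "\<exists>g\<in>edges (step (step H)). {x, q} \<subseteq> g \<and> g \<inter> Z = {}" by blast
  qed
  have "t \<in> edges (step (step (step H)))" if t: "t \<in> nsets (verts H) k" for t
  proof -
    have tk: "finite t" "card t = k" "t \<subseteq> verts H" using t by (auto simp: nsets_def)
    hence "Suc 0 < card t" using k3 by simp
    then obtain x y where xy: "x \<in> t" "y \<in> t" "x \<noteq> y"
      by (metis card_le_Suc0_iff_eq leD tk(1))
    show ?thesis
    \<comment> \<open>Any two vertices of \<open>t\<close> can serve as its core pair. All other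
      core vertices come from \<open>Q\<close> outside \<open>t\<close>, and they are flexible with
      \<open>x\<close> and \<open>y\<close> by \<open>VQ\<close>.\<close>
    proof (rule fan_flex(2)[OF H2, of x y "Q - t"])
      show "card (verts G) \<le> card (Q - t) + 2"
        by (rule card_Q_diff) (use tk in auto)
      show "flex (step (step H)) {h, r}" if "h \<in> Q - t" "r \<in> Q - t \<union> {x, y}" "r \<noteq> h" for h r
      proof -
        have "r \<in> verts H" using that(2) xy(1,2) tk(3) QH by blast
        hence "flex (step (step H)) {r, h}" using VQ that(1,3) by blast
        thus ?thesis by (simp add: insert_commute)
      qed
    qed (use xy tk QH large4 t in auto)
  qed
  moreover have "edges (step (step (step H))) \<subseteq> nsets (verts H) k"
    using k_graph_step[OF H2] by (simp add: k_graph_def)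
  ultimately show ?thesis by blast
qed

lemma step_complete:
  assumes "k_graph k H" and "edges H = nsets (verts H) k"
  shows "step H = H"
proof -
  have "edges (step H) \<subseteq> nsets (verts H) k"
    using k_graph_step[OF assms(1)] by (simp add: k_graph_def)
  hence "edges (step H) = edges H" using assms(2) edges_bootstrap_step[of H k F] by simp
  thus ?thesis by (metis hypergraph.expand verts_bootstrap_step)
qed

text \<open>Among many hubs, \<open>ramsey_independent\<close> finds \<open>card (verts G)\<close>
  ones of which none is exceptional for another, as \<open>complete_of_flexible_hubs\<close>
  requires. A complete hypergraph is a fixed point.\<close>

lemma many_hubs_complete:
  "\<exists>M. \<forall>H. k_graph k H \<longrightarrow> (room + 10) * room \<le> card (verts H) \<longrightarrow> M \<le> card {h. hub H h} \<longrightarrow>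
     step (step (step (step H))) = step (step (step H))"
proof -
  obtain M where M: "\<forall>(A::nat set) B. M \<le> card A \<longrightarrow> (\<forall>h\<in>A. finite (B h) \<and> card (B h) \<le> room) \<longrightarrow>
    (\<exists>A'\<subseteq>A. card A' = card (verts G) \<and> finite A' \<and> (\<forall>h\<in>A'. \<forall>h'\<in>A'. h \<noteq> h' \<longrightarrow> h \<notin> B h'))"
    using ramsey_independent[of room "card (verts G)"] by metis
  show ?thesis
  proof (intro exI[of _ M] allI impI)
    fix H assume H: "k_graph k H" and large: "(room + 10) * room \<le> card (verts H)"
      and card: "M \<le> card {h. hub H h}"
    have "\<forall>h\<in>{h. hub H h}. \<exists>B. finite B \<and> card B \<le> room \<and> (\<forall>q\<in>verts H. q \<notin> B \<longrightarrow> q \<noteq> h \<longrightarrow> flex H {h, q})"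
      by (simp add: hub_def)
    then obtain B where B: "\<And>h. hub H h \<Longrightarrow> finite (B h) \<and> card (B h) \<le> room"
      "\<And>h q. hub H h \<Longrightarrow> q \<in> verts H \<Longrightarrow> q \<notin> B h \<Longrightarrow> q \<noteq> h \<Longrightarrow> flex H {h, q}"
      by (metis mem_Collect_eq)
    then obtain A where A: "A \<subseteq> {h. hub H h}" "card A = card (verts G)"
      "\<forall>h\<in>A. \<forall>h'\<in>A. h \<noteq> h' \<longrightarrow> h \<notin> B h'"
      using M[rule_format, OF card, of B] by blast
    have AH: "hub H h" if "h \<in> A" for h using that A(1) by blast
    have "edges (step (step (step H))) = nsets (verts H) k"
    proof (rule complete_of_flexible_hubs[OF H large _ A(2), of B])
      show "A \<subseteq> verts H" using A(1) by (auto simp: hub_def)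
    qed (use AH B A(3) in blast)+
    thus "step (step (step (step H))) = step (step (step H))"
      using H k_graph_step by (intro step_complete) simp_all
  qed
qed

section \<open>Core pairs\<close>

definition core_pairs :: "nat hypergraph \<Rightarrow> nat set set" where
  "core_pairs H = {p. \<exists>\<psi> e. embedding F H \<psi> \<and> e \<in> edges G \<and> p = (\<lambda>x. \<psi> (Inl x)) ` e}"

text \<open>Here \<open>A\<close> will be the set of hubs and \<open>R\<close> the hubs with all
  their exceptional vertices. The discarded core pairs join a hub to a vertex outside
  \<open>R\<close> and are flexible from the start.\<close>

definition loose_pairs :: "nat set \<Rightarrow> nat set \<Rightarrow> nat hypergraph \<Rightarrow> nat set set" where
  "loose_pairs A R H = {p \<in> core_pairs H. \<forall>h\<in>A. \<forall>w. p = {h, w} \<longrightarrow> w \<in> R}"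

lemma core_pairs_subset: "core_pairs H \<subseteq> Pow (verts H)"
  unfolding core_pairs_def using embedding_core(2) edge_G(1) by blast

lemma finite_loose_pairs: "k_graph k H \<Longrightarrow> finite (loose_pairs A R H)"
  using core_pairs_subset[of H] finite_subset[of "loose_pairs A R H" "Pow (verts H)"]
  by (auto simp: loose_pairs_def k_graph_def)

lemma loose_pairs_step: "loose_pairs A R H \<subseteq> loose_pairs A R (step H)"
proof -
  have "embedding F (step H) \<psi>" if "embedding F H \<psi>" for \<psi>
    using that by (rule embedding_mono) (simp_all add: edges_bootstrap_step)
  hence "core_pairs H \<subseteq> core_pairs (step H)" unfolding core_pairs_def by blast
  thus ?thesis unfolding loose_pairs_def by blast
qed

lemma core_pairs_flex:
  assumes "k_graph k H" and "4 * room \<le> card (verts H)" and "p \<in> core_pairs H"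
  shows "flex (step H) p"
  using assms(3) embedding_pair_flex[OF assms(1,2)] by (auto simp: core_pairs_def)

text \<open>Every core pair of the third step is already flexible after the first, so the whole copy
  can be assembled in the second.\<close>

lemma stationary_loose_pairs:
  assumes H: "k_graph k H" and large: "4 * room \<le> card (verts H)"
    and hubs: "\<And>h q. h \<in> A \<Longrightarrow> q \<in> verts H \<Longrightarrow> q \<notin> R \<Longrightarrow> flex (step H) {h, q}"
    and stat: "loose_pairs A R (step (step (step H))) \<subseteq> loose_pairs A R H"
  shows "step (step (step H)) = step (step H)"
proof (rule bootstrap_step_fixed)
  fix \<psi> assume \<psi>: "embedding F (step (step (step H))) \<psi>"
  have H1: "k_graph k (step H)" using H k_graph_step by simp
  let ?c = "\<lambda>x. \<psi> (Inl x)"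
  have H3: "k_graph k (step (step (step H)))" using H k_graph_step by simp
  have sub: "?c ` verts G \<subseteq> verts H" using embedding_core(2)[OF \<psi>] by simp
  have flex: "flex (step H) (?c ` e)" if e: "e \<in> edges G" for e
  proof -
    have p: "?c ` e \<in> core_pairs (step (step (step H)))" using \<psi> e unfolding core_pairs_def by blast
    show ?thesis
    proof (cases "?c ` e \<in> loose_pairs A R (step (step (step H)))")
      case True
      hence "?c ` e \<in> core_pairs H" using stat by (auto simp: loose_pairs_def)
      thus ?thesis by (rule core_pairs_flex[OF H large])
    next
      case False
      then obtain h w where hw: "h \<in> A" "?c ` e = {h, w}" "w \<notin> R"
        using p unfolding loose_pairs_def by blast
      have "w \<in> verts H" using core_pairs_subset[of "step (step (step H))"] p hw(2) by auto
      thus ?thesis using hubs[OF hw(1) _ hw(3)] hw(2) by simp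
    qed
  qed
  have "\<psi> ` extension_edge k e0 \<in> edges (step (step H))" if e0: "e0 \<in> edges G" for e0
  proof -
    let ?s = "\<lambda>e. if e = e0 then \<psi> ` extension_edge k e0 else ?c ` e"
    have img: "?c ` e \<subseteq> ?c ` verts G" if "e \<in> edges G" for e
      using edge_G(1)[OF that] by (rule image_mono)
    have "\<psi> ` extension_edge k e0 \<in> edges (step (step (step H)))"
      using \<psi> e0 by (simp add: embedding_def edges_F)
    hence nset: "\<psi> ` extension_edge k e0 \<in> nsets (verts H) k"
      using H3 by (auto simp: k_graph_def)
    have "?s e0 \<in> edges (step (step H))"
    proof (rule step_edgeI[where s = ?s and \<phi> = ?c, OF H1 embedding_core(1)[OF \<psi>] _ _ _ _ e0])
      fix e assume e: "e \<in> edges G"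
      show "?s e \<inter> ?c ` verts G = ?c ` e"
        using embedding_core(3)[OF \<psi> e0] img[OF e] by (simp add: Int_absorb2)
      show "?s e \<inter> ?s e' \<subseteq> ?c ` verts G" if "e' \<in> edges G" "e \<noteq> e'" for e'
        using img[OF e] img[OF that(1)] that(2) by (cases "e = e0") (simp_all add: le_infI1 le_infI2)
      show "flex (step H) (?s e)" if "e \<noteq> e0" using flex[OF e] that by simp
    qed (use sub nset in simp_all)
    thus ?thesis by simp
  qed
  thus "embedding F (step (step H)) \<psi>"
    using \<psi> by (auto simp: embedding_def edges_F)
qed

text \<open>Some edge \<open>e\<close> of \<open>G\<close> carries many loose pairs, and copies
  indexed by these pairs contain a large sunflower. Its kernel cannot contain both ends of
  \<open>e\<close>, as the pairs differ. With one end in the kernel, that end is a hub by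
  \<open>hub_of_sunflower\<close>; with none, \<open>hub_of_spread_sunflower\<close> applies to a
  copy whose petal avoids \<open>R\<close>.\<close>

lemma hub_of_many_loose_pairs:
  "\<exists>L. \<forall>H A R. k_graph k H \<longrightarrow> 4 * room \<le> card (verts H) \<longrightarrow> A \<subseteq> R \<longrightarrow> finite R \<longrightarrow> card R \<le> r \<longrightarrow>
     L \<le> card (loose_pairs A R H) \<longrightarrow> (\<exists>h. hub (step (step H)) h \<and> h \<notin> A)"
proof -
  obtain M1 where M1: "sunflower_size (room + 2) M1" using sunflower_size_exists ..
  \<comment> \<open>The sunflower must have more than \<open>M1\<close> members for the spread case,
    at least \<open>room + 2\<close> for the one-sided case, and more than \<open>r\<close> so that
    some petal avoids \<open>R\<close>.\<close>
  obtain M2 where M2: "sunflower_size (M1 + r + room + 3) M2" using sunflower_size_exists ..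
  show ?thesis
  proof (rule exI[of _ "Suc (M2 * card (edges G))"], intro allI impI)
    fix H A R
    assume H: "k_graph k H" and large: "4 * room \<le> card (verts H)" and AR: "A \<subseteq> R"
      and R: "finite R" "card R \<le> r" and many: "Suc (M2 * card (edges G)) \<le> card (loose_pairs A R H)"
    define P where "P = (\<lambda>e. {p \<in> loose_pairs A R H. \<exists>\<psi>. embedding F H \<psi> \<and> p = (\<lambda>x. \<psi> (Inl x)) ` e})"
    have "loose_pairs A R H = (\<Union>e\<in>edges G. P e)"
      unfolding P_def loose_pairs_def core_pairs_def by blast
    moreover have "card (\<Union>e\<in>edges G. P e) \<le> M2 * card (edges G)"
      if "\<And>e. e \<in> edges G \<Longrightarrow> card (P e) \<le> M2"
      using finite_G(2) that by (rule card_UN_le_mult)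
    ultimately obtain e where e: "e \<in> edges G" "M2 \<le> card (P e)"
      using many by (metis Suc_n_not_le_n le_trans nat_le_linear)
    have "\<forall>p\<in>P e. \<exists>\<psi>. embedding F H \<psi> \<and> p = (\<lambda>x. \<psi> (Inl x)) ` e" by (simp add: P_def)
    then obtain \<psi> where \<psi>: "\<And>p. p \<in> P e \<Longrightarrow> embedding F H (\<psi> p)"
      "\<And>p. p \<in> P e \<Longrightarrow> p = (\<lambda>x. \<psi> p (Inl x)) ` e"
      by metis
    have "\<exists>J K. J \<subseteq> P e \<and> card J = M1 + r + room + 3 \<and> sunflower J \<psi> (verts F) K"
      using e(2) by (rule sunflower_sizeD[OF M2]) (rule \<psi>(1))
    then obtain J K where J: "J \<subseteq> P e" "card J = M1 + r + room + 3" and sun: "sunflower J \<psi> (verts F) K"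
      by (elim exE conjE) (rule that; assumption)
    have emb: "embedding F H (\<psi> p)" if "p \<in> J" for p using \<psi>(1) that J(1) by blast
    have R_J: "card R < card J" using R(2) J(2) by simp
    obtain p0 where p0: "p0 \<in> J" using J(2) by fastforce
    have one_sided: "\<exists>h. hub (step (step H)) h \<and> h \<notin> A"
      if ab: "e = {a, b}" "Inl a \<in> K" "Inl b \<notin> K" for a b
    proof -
      have bF: "Inl b \<in> verts F" using edge_G(1)[OF e(1)] ab(1) core_in_F by simp
      have "hub (step H) (\<psi> p0 (Inl a))"
        by (rule hub_of_sunflower[OF H large emb sun _ _ ab(2,3) p0]) (use J(2) e(1) ab(1) in simp_all)
      \<comment> \<open>Were this vertex in \<open>A\<close>, looseness would force the other end of
        every pair in \<open>J\<close> into \<open>R\<close>, but some petal avoids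
        \<open>R\<close>.\<close>
      moreover have "\<psi> p0 (Inl a) \<notin> A"
      proof
        assume hA: "\<psi> p0 (Inl a) \<in> A"
        obtain p where p: "p \<in> J" "\<And>x. x \<in> verts F \<Longrightarrow> x \<notin> K \<Longrightarrow> \<psi> p x \<notin> R"
          using sunflower_avoid[OF sun R(1) R_J] by metis
        have "p = {\<psi> p (Inl a), \<psi> p (Inl b)}" using \<psi>(2)[of p] p(1) J(1) ab(1) by auto
        hence "p = {\<psi> p0 (Inl a), \<psi> p (Inl b)}"
          using sunflower_kernel[OF sun ab(2) p0 p(1)] by simp
        moreover have "p \<in> loose_pairs A R H" using p(1) J(1) by (auto simp: P_def)
        ultimately have "\<psi> p (Inl b) \<in> R" using hA unfolding loose_pairs_def by blast
        thus False using p(2)[OF bF ab(3)] by simp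
      qed
      ultimately show ?thesis using hub_step by blast
    qed
    obtain a b where ab: "e = {a, b}" "a \<noteq> b" "a \<in> verts G" "b \<in> verts G" using edge_G_pair[OF e(1)] .
    have bF: "Inl b \<in> verts F" using ab(4) core_in_F by simp
    consider "Inl a \<in> K" "Inl b \<in> K" | "Inl a \<in> K" "Inl b \<notin> K" | "Inl a \<notin> K" "Inl b \<in> K"
      | "Inl a \<notin> K" "Inl b \<notin> K" by blast
    thus "\<exists>h. hub (step (step H)) h \<and> h \<notin> A"
    proof cases
      case 1
      \<comment> \<open>The copies are indexed by their core pairs over \<open>e\<close>, so equal
        core pairs mean equal indices.\<close>
      have "p = p0" if p: "p \<in> J" for p
        using \<psi>(2)[of p] \<psi>(2)[of p0] p p0 J(1) ab(1) sunflower_kernel[OF sun 1(1) p p0]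
          sunflower_kernel[OF sun 1(2) p p0] by auto
      hence "J \<subseteq> {p0}" by blast
      hence "card J \<le> 1" using card_mono[of "{p0}" J] by simp
      thus ?thesis using J(2) by simp
    next
      case 2 thus ?thesis using one_sided ab(1) by blast
    next
      case 3 thus ?thesis using one_sided[of b a] ab(1) by (simp add: insert_commute)
    next
      case 4
      obtain p where p: "p \<in> J" "\<And>x. x \<in> verts F \<Longrightarrow> x \<notin> K \<Longrightarrow> \<psi> p x \<notin> R"
        using sunflower_avoid[OF sun R(1) R_J] by metis
      have "hub (step (step H)) (\<psi> p (Inl b))"
        by (rule hub_of_spread_sunflower[OF H large emb sun M1 _ _ 4(1) p(1)])
           (use J(2) e(1) ab(1) in simp_all)
      moreover have "\<psi> p (Inl b) \<notin> A" using p(2)[OF bF 4(2)] AR by blast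
      ultimately show ?thesis by blast
    qed
  qed
qed

section \<open>Bounding the running time\<close>

lemma funpow_step_k_graph: "k_graph k H \<Longrightarrow> k_graph k ((step ^^ t) H)"
  by (induction t) (simp_all add: k_graph_step)

lemma verts_funpow_step [simp]: "verts ((step ^^ t) H) = verts H"
  by (induction t) simp_all

lemma flex_funpow_step: "flex H s \<Longrightarrow> flex ((step ^^ t) H) s"
  by (induction t) (simp_all add: flex_step)

lemma hub_funpow_step: "hub H h \<Longrightarrow> hub ((step ^^ t) H) h"
  by (induction t) (simp_all add: hub_step)

text \<open>The sets \<open>A\<close> and \<open>R\<close> are fixed at the start. By
  \<open>stationary_loose_pairs\<close>, as long as the process runs, every three steps add a loose
  pair. After \<open>3 * L\<close> steps there are \<open>L\<close> of them, and
  \<open>hub_of_many_loose_pairs\<close> yields a new hub two steps later.\<close>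

lemma new_hub_or_stop:
  "\<exists>D. \<forall>H. k_graph k H \<longrightarrow> 4 * room \<le> card (verts H) \<longrightarrow> card {h. hub H h} \<le> M \<longrightarrow>
     (\<exists>s\<le>D. step ((step ^^ s) H) = (step ^^ s) H) \<or> (\<exists>h. hub ((step ^^ D) H) h \<and> \<not> hub H h)"
proof -
  obtain L where L: "\<forall>H A R. k_graph k H \<longrightarrow> 4 * room \<le> card (verts H) \<longrightarrow> A \<subseteq> R \<longrightarrow> finite R \<longrightarrow>
    card R \<le> M + room * M \<longrightarrow> L \<le> card (loose_pairs A R H) \<longrightarrow> (\<exists>h. hub (step (step H)) h \<and> h \<notin> A)"
    \<comment> \<open>At most \<open>M\<close> hubs, each with at most \<open>room\<close>
      exceptional vertices.\<close>
    using hub_of_many_loose_pairs[of "M + room * M"] ..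
  show ?thesis
  proof (rule exI[of _ "3 * L + 2"], intro allI impI)
    fix H :: "nat hypergraph" assume H: "k_graph k H" and large: "4 * room \<le> card (verts H)"
      and M: "card {h. hub H h} \<le> M"
    define A where "A = {h. hub H h}"
    have finA: "finite A"
    proof (rule finite_subset)
      show "A \<subseteq> verts H" by (auto simp: A_def hub_def)
      show "finite (verts H)" using H by (simp add: k_graph_def)
    qed
    have "\<forall>h\<in>A. \<exists>B. finite B \<and> card B \<le> room \<and> (\<forall>q\<in>verts H. q \<notin> B \<longrightarrow> q \<noteq> h \<longrightarrow> flex H {h, q})"
      by (simp add: hub_def A_def)
    then obtain B where B: "\<And>h. h \<in> A \<Longrightarrow> finite (B h) \<and> card (B h) \<le> room"
      "\<And>h q. h \<in> A \<Longrightarrow> q \<in> verts H \<Longrightarrow> q \<notin> B h \<Longrightarrow> q \<noteq> h \<Longrightarrow> flex H {h, q}"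
      by metis
    define R where "R = A \<union> (\<Union>h\<in>A. B h)"
    have finR: "finite R" using finA B(1) by (auto simp: R_def)
    have "card (\<Union>h\<in>A. B h) \<le> room * card A" by (rule card_UN_le_mult[OF finA]) (use B(1) in blast)
    also have "\<dots> \<le> room * M" using M by (simp add: A_def)
    finally have card_R: "card R \<le> M + room * M"
      using card_Un_le[of A "\<Union>h\<in>A. B h"] M by (simp add: R_def A_def)
    have hubs: "flex (step ((step ^^ t) H)) {h, q}" if "h \<in> A" "q \<in> verts H" "q \<notin> R" for h q t
    proof -
      have "flex H {h, q}" using B(2)[OF that(1,2)] that by (auto simp: R_def)
      thus ?thesis by (intro flex_step flex_funpow_step)
    qed
    let ?l = "\<lambda>t. loose_pairs A R ((step ^^ t) H)"
    have k_graph_t: "k_graph k ((step ^^ t) H)" for t by (rule funpow_step_k_graph[OF H])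
    show "(\<exists>s\<le>3 * L + 2. step ((step ^^ s) H) = (step ^^ s) H) \<or>
      (\<exists>h. hub ((step ^^ (3 * L + 2)) H) h \<and> \<not> hub H h)"
    proof (cases "\<exists>s\<le>3 * L + 2. step ((step ^^ s) H) = (step ^^ s) H")
      case False
      have "j \<le> card (?l (3 * j))" if "j \<le> L" for j
        using that
      proof (induction j)
        case (Suc j)
        have pow: "(step ^^ (3 * Suc j)) H = step (step (step ((step ^^ (3 * j)) H)))"
          by (simp add: numeral_3_eq_3)
        have "?l (3 * j) \<subseteq> ?l (3 * Suc j)"
          unfolding pow using loose_pairs_step by (meson order_trans)
        moreover have "\<not> ?l (3 * Suc j) \<subseteq> ?l (3 * j)"
        proof
          assume "?l (3 * Suc j) \<subseteq> ?l (3 * j)"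
          hence "step (step (step ((step ^^ (3 * j)) H))) = step (step ((step ^^ (3 * j)) H))"
            unfolding pow using large hubs by (intro stationary_loose_pairs[OF k_graph_t]) simp_all
          hence "step ((step ^^ (3 * j + 2)) H) = (step ^^ (3 * j + 2)) H" by simp
          thus False using False Suc.prems by (metis Suc_leD add_le_mono1 mult_le_mono2)
        qed
        ultimately have "card (?l (3 * j)) < card (?l (3 * Suc j))"
          by (intro psubset_card_mono finite_loose_pairs[OF k_graph_t]) blast
        thus ?case using Suc by simp
      qed simp
      hence "L \<le> card (?l (3 * L))" by simp
      hence "\<exists>h. hub (step (step ((step ^^ (3 * L)) H))) h \<and> h \<notin> A"
        by (intro L[rule_format, OF k_graph_t _ _ finR card_R]) (use large in \<open>simp_all add: R_def\<close>)
      thus ?thesis by (simp add: A_def)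
    qed simp
  qed
qed

text \<open>Each block of \<open>D\<close> steps stops the process or adds a hub as long as there
  are at most \<open>M\<close> hubs. After \<open>M\<close> blocks there are at least
  \<open>M\<close> hubs unless it has stopped, and \<open>many_hubs_complete\<close> finishes in
  three more steps.\<close>

lemma step_stops:
  "\<exists>C. \<forall>H. k_graph k H \<longrightarrow> (room + 10) * room \<le> card (verts H) \<longrightarrow>
     (\<exists>s\<le>C. step ((step ^^ s) H) = (step ^^ s) H)"
proof -
  obtain M where M: "\<forall>H. k_graph k H \<longrightarrow> (room + 10) * room \<le> card (verts H) \<longrightarrow> M \<le> card {h. hub H h} \<longrightarrow>
     step (step (step (step H))) = step (step (step H))"
    using many_hubs_complete ..
  obtain D where D: "\<forall>H. k_graph k H \<longrightarrow> 4 * room \<le> card (verts H) \<longrightarrow> card {h. hub H h} \<le> M \<longrightarrow>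
     (\<exists>s\<le>D. step ((step ^^ s) H) = (step ^^ s) H) \<or> (\<exists>h. hub ((step ^^ D) H) h \<and> \<not> hub H h)"
    using new_hub_or_stop ..
  show ?thesis
  proof (rule exI[of _ "M * D + 3"], intro allI impI)
    fix H :: "nat hypergraph" assume H: "k_graph k H" and large: "(room + 10) * room \<le> card (verts H)"
    have "4 * room \<le> (room + 10) * room" by (simp add: mult_le_mono1)
    hence large4: "4 * room \<le> card (verts H)" using large by linarith
    let ?P = "\<lambda>t. (step ^^ t) H"
    have fin: "finite {h. hub (?P t) h}" for t
    proof (rule finite_subset)
      show "{h. hub (?P t) h} \<subseteq> verts H" by (auto simp: hub_def)
      show "finite (verts H)" using H by (simp add: k_graph_def)
    qed
    have "(\<exists>s\<le>j * D. step (?P s) = ?P s) \<or> j \<le> card {h. hub (?P (j * D)) h}" if "j \<le> M" for j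
      using that
    proof (induction j)
      case (Suc j)
      show ?case
      proof (cases "\<exists>s\<le>j * D. step (?P s) = ?P s")
        case True
        thus ?thesis by (metis add_leE le_add2 le_trans mult_Suc)
      next
        case False
        hence j: "j \<le> card {h. hub (?P (j * D)) h}"
          using Suc.IH[OF Suc_leD[OF Suc.prems]] by (elim disjE) (simp_all only: False simp_thms)
        have pow: "(step ^^ s) (?P (j * D)) = ?P (s + j * D)" for s by (simp add: funpow_add)
        have mono: "{h. hub (?P (j * D)) h} \<subseteq> {h. hub (?P (Suc j * D)) h}"
          using hub_funpow_step[of "?P (j * D)" _ D] by (auto simp: pow)
        show ?thesis
        proof (cases "card {h. hub (?P (j * D)) h} \<le> M")
          case True
          have "(\<exists>s\<le>D. step ((step ^^ s) (?P (j * D))) = (step ^^ s) (?P (j * D))) \<or>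
            (\<exists>h. hub ((step ^^ D) (?P (j * D))) h \<and> \<not> hub (?P (j * D)) h)"
            using True large4 by (intro D[rule_format] funpow_step_k_graph[OF H]) simp_all
          thus ?thesis
          proof
            assume "\<exists>s\<le>D. step ((step ^^ s) (?P (j * D))) = (step ^^ s) (?P (j * D))"
            then obtain s where "s \<le> D" "step (?P (s + j * D)) = ?P (s + j * D)"
              unfolding pow by blast
            thus ?thesis by (intro disjI1 exI[of _ "s + j * D"]) simp
          next
            assume "\<exists>h. hub ((step ^^ D) (?P (j * D))) h \<and> \<not> hub (?P (j * D)) h"
            hence "{h. hub (?P (j * D)) h} \<subset> {h. hub (?P (Suc j * D)) h}"
              using mono by (auto simp: pow)
            hence "card {h. hub (?P (j * D)) h} < card {h. hub (?P (Suc j * D)) h}"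
              by (rule psubset_card_mono[OF fin])
            thus ?thesis using j by simp
          qed
        next
          case False
          \<comment> \<open>More than \<open>M\<close> hubs already exceed the goal
            \<open>Suc j\<close>, and hubs are never lost.\<close>
          thus ?thesis using card_mono[OF fin mono] Suc.prems by simp
        qed
      qed
    qed simp
    hence "(\<exists>s\<le>M * D. step (?P s) = ?P s) \<or> M \<le> card {h. hub (?P (M * D)) h}" by simp
    thus "\<exists>s\<le>M * D + 3. step (?P s) = ?P s"
    proof
      assume "M \<le> card {h. hub (?P (M * D)) h}"
      hence "step (step (step (step (?P (M * D))))) = step (step (step (?P (M * D))))"
        using large by (intro M[rule_format] funpow_step_k_graph[OF H]) simp_all
      hence "step (?P (M * D + 3)) = ?P (M * D + 3)" by (simp add: numeral_3_eq_3)
      thus ?thesis by blast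
    qed (meson le_add1 le_trans)
  qed
qed

end

section \<open>From iterated steps to the maximum running time\<close>

lemma bootstrap_process_funpow: "bootstrap_process k F H t = (bootstrap_step k F ^^ t) H"
  by (induction t) simp_all

lemma running_time_le:
  "bootstrap_process k F H t = bootstrap_process k F H (Suc t) \<Longrightarrow> running_time k F H \<le> t"
  unfolding running_time_def by (rule Least_le)

lemma max_running_time_le:
  assumes "\<And>H :: nat hypergraph. k_graph k H \<Longrightarrow> card (verts H) = n \<Longrightarrow> running_time k F H \<le> C"
  shows "max_running_time k F n \<le> C"
proof -
  have "\<forall>t\<in>running_times k F n. t \<le> C" using assms by (auto simp: running_times_def)
  thus ?thesis
    unfolding max_running_time_def using running_times_finite_nonempty[of k F n] by simp
qed

text \<open>For the hosts too small for \<open>step_stops\<close>: the bound is monotone in the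
  number of vertices and therefore uniform over all of them.\<close>

lemma running_time_le_power:
  assumes "k_graph k H"
  shows "running_time k F H \<le> 2 ^ card (verts H)"
proof -
  obtain t where t: "t \<le> card (verts H) choose k" "bootstrap_process k F H t = bootstrap_process k F H (Suc t)"
    using bootstrap_process_stabilises[OF assms] by blast
  have "card (verts H) choose k \<le> 2 ^ card (verts H)"
    by (cases "k \<le> card (verts H)") (auto intro: binomial_le_pow2 simp: binomial_eq_0)
  thus ?thesis using running_time_le[OF t(2)] t(1) by linarith
qed

theorem theorem1p1:
  fixes k :: nat and G :: "'a hypergraph"
  assumes "k \<ge> 3" and "k_graph 2 G"
  shows "\<exists>C::nat. \<forall>n::nat. max_running_time k (k_extension k G) n \<le> C"
proof (cases "edges G = {}")
  case True
  \<comment> \<open>Without edges an embedding depends on the vertex set of the host only, which a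
    step leaves unchanged.\<close>
  have "bootstrap_step k (k_extension k G) H = H" for H :: "nat hypergraph"
    using True by (intro bootstrap_step_fixed) (simp add: embedding_def k_extension_def)
  hence "running_time k (k_extension k G) H \<le> 0" for H :: "nat hypergraph"
    by (intro running_time_le) simp
  thus ?thesis by (intro exI[of _ 0] allI max_running_time_le)
next
  case False
  then interpret extension_percolation k G using assms by unfold_locales
  obtain C where C: "\<forall>H. k_graph k H \<longrightarrow> (room + 10) * room \<le> card (verts H) \<longrightarrow>
     (\<exists>s\<le>C. step ((step ^^ s) H) = (step ^^ s) H)"
    using step_stops ..
  \<comment> \<open>The first summand serves the large hosts, the second the small ones.\<close>
  have "running_time k F H \<le> C + 2 ^ ((room + 10) * room)" if H: "k_graph k H" for H :: "nat hypergraph"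
  proof (cases "(room + 10) * room \<le> card (verts H)")
    case True
    then obtain s where "s \<le> C" "step ((step ^^ s) H) = (step ^^ s) H" using C H by blast
    thus ?thesis using running_time_le[of k F H s] by (simp add: bootstrap_process_funpow)
  next
    case False
    hence "(2::nat) ^ card (verts H) \<le> 2 ^ ((room + 10) * room)" by (intro power_increasing) simp_all
    thus ?thesis using running_time_le_power[OF H, of F] by linarith
  qed
  thus ?thesis by (intro exI allI max_running_time_le)
qed

end
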